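(* Let $b\ge c>0$, let $\alpha\ge\alpha_0$, let $n$ be a positive integer, and let $a_0,a_1,\ldots,a_n$ be real numbers such that $a_0\ge a_1\ge\cdots\ge a_n>0$ and $$(b+n-k)\,k\,a_k\le(c+n-k)(k-\alpha)\,a_{k-1},\qquad 1\le k\le n.$$ Then for all $-1<x<1$ and all $\lambda>0$, $$\sum_{k=0}^n a_k\frac{C_k^{\lambda}(x)}{C_k^{\lambda}(1)}>0.$$
   Context: $\alpha_0$ denotes the unique root in $(0,1)$ of the equation $\int_0^{3\pi/2}\frac{\cos t}{t^{\alpha}}\,dt=0$ (in the unknown $\alpha$); numerically $\alpha_0=0.3084437\ldots$. $C_k^{\lambda}(x)$ denotes the Gegenbauer (ultraspherical) polynomial of degree $k$ and order $\lambda>0$, given by the generating function $(1-2xr+r^2)^{-\lambda}=\sum_{k=0}^{\infty}C_k^{\lambda}(x)r^k$. *)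

theory Defs
  imports "HOL-Complex_Analysis.Complex_Analysis"
begin

text \<open>
  For \<open>0 < a < 1\<close> the singularity at \<open>t = 0\<close> is absolutely integrable
  (\<open>cos_div_powr_abs_integrable\<close>), so the Henstock-Kurzweil integral is the usual one. The root
  exists and is unique by \<open>ex1_alpha0\<close>.
\<close>
definition alpha0 :: real where
  "alpha0 = (THE a. 0 < a \<and> a < 1 \<and> integral {0..3 * pi / 2} (\<lambda>t. cos t / t powr a) = 0)"

text \<open>
  The \<open>k\<close>-th coefficient of \<open>(1 - 2 x r + r\<^sup>2) powr (-l)\<close> as a formal power series in \<open>r\<close>,
  i.e. of the binomial series \<open>(1 + u) powr (-l)\<close> at \<open>u = -2 x r + r\<^sup>2\<close>. The lemma
  \<open>gegenbauer_generating_function\<close> is the generating function as an identity of real functions.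
\<close>
definition gegenbauer :: "real \<Rightarrow> nat \<Rightarrow> real \<Rightarrow> real" where
  "gegenbauer l k x =
     fps_nth (fps_binomial (-l) oo (fps_const (-2 * x) * fps_X + fps_X ^ 2)) k"

lemma of_real_gegenbauer:
  "(of_real (gegenbauer l k x) :: complex) =
     fps_nth (fps_binomial (of_real (-l)) oo (fps_const (of_real (-2 * x)) * fps_X + fps_X ^ 2)) k"
proof -
  define P where "P = fps_const (-2 * x) * fps_X + fps_X ^ 2"
  define Q :: "complex fps" where "Q = fps_const (of_real (-2 * x)) * fps_X + fps_X ^ 2"
  have PQ: "(of_real (fps_nth P k) :: complex) = fps_nth Q k" for k
    by (simp add: P_def Q_def fps_X_power_nth)
  have pow: "(of_real (fps_nth (P ^ i) k) :: complex) = fps_nth (Q ^ i) k" for i k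
  proof (induction i arbitrary: k)
    case (Suc i)
    then show ?case by (simp add: fps_mult_nth PQ)
  qed simp
  have gb: "(of_real (-l gchoose i) :: complex) = (of_real (-l) gchoose i)" for i
    by (simp add: gbinomial_prod_rev)
  show ?thesis
    unfolding gegenbauer_def P_def[symmetric] Q_def[symmetric] fps_compose_nth of_real_sum
    by (intro sum.cong refl) (simp only: of_real_mult pow gb fps_binomial_nth)
qed

lemma mult_Re_pos_notin_nonpos_Reals:
  fixes u v :: complex
  assumes "Re u > 0" "Re v > 0"
  shows "u * v \<notin> \<real>\<^sub>\<le>\<^sub>0"
proof
  assume "u * v \<in> \<real>\<^sub>\<le>\<^sub>0"
  then have im: "Re u * Im v + Im u * Re v = 0" and re: "Re u * Re v - Im u * Im v \<le> 0"
    by (auto simp: complex_nonpos_Reals_iff)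
  from im have "Im v = - (Im u * Re v) / Re u" using assms by (simp add: field_simps)
  then have "Im u * Im v = - (Im u)\<^sup>2 * (Re v / Re u)" by (simp add: power2_eq_square)
  moreover have "(Im u)\<^sup>2 * (Re v / Re u) \<ge> 0" using assms by simp
  moreover have "Re u * Re v > 0" using assms by simp
  ultimately show False using re by linarith
qed

lemma gegenbauer_generating_function:
  assumes x: "-1 \<le> x" "x \<le> 1" and r: "\<bar>r\<bar> < 1"
  shows "(\<lambda>k. gegenbauer l k x * r ^ k) sums (1 - 2 * x * r + r\<^sup>2) powr (-l)"
proof -
  define Q :: "complex fps" where "Q = fps_const (of_real (-2 * x)) * fps_X + fps_X ^ 2"
  define g :: "complex \<Rightarrow> complex" where "g = (\<lambda>z. of_real (-2 * x) * z + z ^ 2)"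
  have "g has_fps_expansion Q" unfolding g_def Q_def by (intro fps_expansion_intros)
  then have "((\<lambda>z. (1 + z) powr (of_real (-l))) \<circ> g) has_fps_expansion
      (fps_binomial (of_real (-l)) oo Q)"
    by (intro has_fps_expansion_compose has_fps_expansion_binomial_complex) (simp_all add: Q_def)
  then have exp: "(\<lambda>z. (1 + g z) powr (of_real (-l))) has_fps_expansion
      (fps_binomial (of_real (-l)) oo Q)" by (simp add: o_def)
  define w where "w = Complex x (sqrt (1 - x\<^sup>2))"
  have x2: "x\<^sup>2 \<le> 1" using x by (simp add: abs_square_le_1)
  have w1: "w + cnj w = of_real (2 * x)" by (simp add: w_def complex_eq_iff)
  have w2: "w * cnj w = 1"
    using x2 by (simp add: w_def complex_eq_iff power2_eq_square[symmetric])
  have nw: "norm w = 1" using x2 by (simp add: w_def cmod_def)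
  have fact: "1 + g z = (1 - w * z) * (1 - cnj w * z)" for z
  proof -
    have "(1 - w * z) * (1 - cnj w * z) = 1 - (w + cnj w) * z + (w * cnj w) * z ^ 2"
      by (simp add: algebra_simps power2_eq_square)
    then show ?thesis unfolding w1 w2 g_def by simp
  qed
  have Re1: "Re (1 - v) > 0" if "norm v < 1" for v :: complex
    using complex_Re_le_cmod[of v] that by simp
  have "(\<lambda>z. (1 + g z) powr (of_real (-l))) holomorphic_on eball 0 1"
    unfolding g_def
  proof (intro holomorphic_intros)
    fix z :: complex assume "z \<in> eball 0 1"
    then have "norm z < 1" by (simp add: in_eball_iff one_ereal_def)
    then have "Re (1 - w * z) > 0" "Re (1 - cnj w * z) > 0"
      using nw by (simp_all only: Re1 norm_mult complex_mod_cnj mult_1)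
    then have "1 + g z \<notin> \<real>\<^sub>\<le>\<^sub>0" unfolding fact by (rule mult_Re_pos_notin_nonpos_Reals)
    then show "1 + (of_real (-2 * x) * z + z ^ 2) \<notin> \<real>\<^sub>\<le>\<^sub>0" by (simp add: g_def)
  qed
  from has_fps_expansion_imp_sums_complex[OF exp this, of "of_real r"] r
  have S: "(\<lambda>k. fps_nth (fps_binomial (of_real (-l)) oo Q) k * of_real r ^ k) sums
      ((1 + g (of_real r)) powr (of_real (-l)))"
    by (simp add: one_ereal_def)
  have pos: "0 \<le> 1 - 2 * x * r + r\<^sup>2"
  proof -
    have "1 - 2 * x * r + r\<^sup>2 = (r - x)\<^sup>2 + (1 - x\<^sup>2)"
      by (simp add: power2_eq_square algebra_simps)
    then show ?thesis using x2 zero_le_power2[of "r - x"] by linarith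
  qed
  have "(1 + g (of_real r)) powr (of_real (-l)) =
      of_real ((1 - 2 * x * r + r\<^sup>2) powr (-l))"
  proof -
    have "1 + g (of_real r) = of_real (1 - 2 * x * r + r\<^sup>2)" by (simp add: g_def)
    then show ?thesis by (simp only: powr_of_real[OF pos])
  qed
  with S have "(\<lambda>k. of_real (gegenbauer l k x * r ^ k) :: complex) sums
      of_real ((1 - 2 * x * r + r\<^sup>2) powr (-l))"
    by (simp only: of_real_mult of_real_gegenbauer of_real_power Q_def)
  then show ?thesis by (simp only: sums_of_real_iff)
qed

lemma cos_div_powr_abs_integrable:
  fixes a c :: real
  assumes "a < 1" "0 \<le> c"
  shows "(\<lambda>t. cos t / t powr a) absolutely_integrable_on {0..c}"
proof (rule measurable_bounded_by_integrable_imp_absolutely_integrable)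
  show "(\<lambda>t. t powr (-a)) integrable_on {0..c}"
    using assms by (intro integrable_on_powr_from_0) auto
  have "(\<lambda>t. cos t / t powr a) \<in> borel_measurable borel" by measurable
  then show "(\<lambda>t. cos t / t powr a) \<in> borel_measurable (lebesgue_on {0..c})"
    by (intro measurable_restrict_space1 measurable_completion) simp
  show "norm (cos t / t powr a) \<le> t powr (-a)" if "t \<in> {0..c}" for t
    by (simp add: powr_minus divide_simps abs_cos_le_one)
qed auto

lemma cos_div_powr_integrable:
  fixes a c :: real
  assumes "a < 1" "0 \<le> c"
  shows "(\<lambda>t. cos t / t powr a) integrable_on {0..c}"
  using cos_div_powr_abs_integrable[OF assms] set_lebesgue_integral_eq_integral(1) by blast

lemma alpha0_root_unique_aux:
  fixes a b :: real
  assumes ab: "a < b" "b < 1"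
    and Ia: "integral {0..3 * pi / 2} (\<lambda>t. cos t / t powr a) = 0"
    and Ib: "integral {0..3 * pi / 2} (\<lambda>t. cos t / t powr b) = 0"
  shows False
proof -
  define p :: real where "p = pi / 2"
  have p: "p > 0" by (simp add: p_def)
  define h where "h t = p powr b * (cos t / t powr b) - p powr a * (cos t / t powr a)" for t
  have intg: "(\<lambda>t. cos t / t powr a) integrable_on {0..3 * pi / 2}"
    "(\<lambda>t. cos t / t powr b) integrable_on {0..3 * pi / 2}"
    using ab by (intro cos_div_powr_integrable; simp)+
  have hI: "(h has_integral 0) {0..3 * pi / 2}"
    unfolding h_def
    using has_integral_diff[OF has_integral_mult_right[OF integrable_integral[OF intg(2)], of "p powr b"]
       has_integral_mult_right[OF integrable_integral[OF intg(1)], of "p powr a"]]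
    by (simp add: Ia Ib)
  have h_eq: "h t = cos t * ((p / t) powr b - (p / t) powr a)" if "t > 0" for t
    using that p by (simp add: h_def powr_divide algebra_simps)
  have h_nonneg: "h t \<ge> 0" if t: "t \<in> {0..3 * pi / 2}" for t
  proof (cases "t = 0")
    case False
    then have t0: "t > 0" using t by simp
    show ?thesis
    proof (cases "t \<le> p")
      case True
      then have "cos t \<ge> 0" "(p / t) powr b \<ge> (p / t) powr a"
        using t0 ab by (auto intro!: cos_ge_zero powr_mono simp: p_def)
      then show ?thesis by (simp add: h_eq t0)
    next
      case False
      then have "p / t \<le> 1" "p / t > 0" using t0 p by auto
      then have "(p / t) powr b \<le> (p / t) powr a" using ab by (intro powr_mono') auto
      moreover have "cos t \<le> 0"
      proof -
        have "cos (t - pi) \<ge> 0"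
          using False t by (intro cos_ge_zero) (auto simp: p_def)
        then show ?thesis by simp
      qed
      ultimately show ?thesis by (simp add: h_eq t0 mult_nonpos_nonpos)
    qed
  qed (simp add: h_def)
  have sub: "{p..3 * pi / 2} \<subseteq> {0..3 * pi / 2}" by (auto simp: p_def)
  have cont: "continuous_on {p..3 * pi / 2} h"
    unfolding h_def using p by (intro continuous_intros) auto
  have hint: "h integrable_on {p..3 * pi / 2}" using cont by (rule integrable_continuous_interval)
  have "integral {p..3 * pi / 2} h \<le> integral {0..3 * pi / 2} h"
    by (rule integral_subset_le[OF sub hint]) (use hI h_nonneg in \<open>blast+\<close>)
  moreover have "integral {p..3 * pi / 2} h \<ge> 0"
    using sub h_nonneg by (intro integral_nonneg hint) auto
  ultimately have "integral {p..3 * pi / 2} h = 0"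
    using hI by (simp add: integral_unique)
  then have "(h has_integral 0) (cbox p (3 * pi / 2))"
    using integrable_integral[OF hint] by simp
  then have "h pi = 0"
    using cont sub by (intro has_integral_0_cbox_imp_0[of p "3 * pi / 2" h])
      (auto intro!: h_nonneg simp: p_def box_ne_empty)
  moreover have "h pi = (1 / 2) powr a - (1 / 2) powr b"
    by (subst h_eq) (simp_all add: p_def)
  moreover have "(1 / 2 :: real) powr a > (1 / 2) powr b" using ab by (intro powr_less_mono') auto
  ultimately show False by simp
qed

lemma cos_div_powr_integral_continuous:
  "continuous_on {0..1/2} (\<lambda>a::real. integral {0..3 * pi / 2} (\<lambda>t. cos t / t powr a))"
  unfolding continuous_on_sequentially
proof (intro allI impI ballI, elim conjE)
  fix u :: "nat \<Rightarrow> real" and a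
  assume u: "\<forall>n. u n \<in> {0..1/2}" and a: "a \<in> {0..1/2}" and lim: "u \<longlonglongrightarrow> a"
  define g :: "real \<Rightarrow> real" where "g = (\<lambda>t. 1 + t powr (-(1/2)))"
  have "(\<lambda>n. integral {0..3 * pi / 2} (\<lambda>t. cos t / t powr (u n)))
      \<longlonglongrightarrow> integral {0..3 * pi / 2} (\<lambda>t. cos t / t powr a)"
  proof (rule dominated_convergence(2)[where h = g])
    show "(\<lambda>t. cos t / t powr (u n)) integrable_on {0..3 * pi / 2}" for n
      using u[rule_format, of n] by (intro cos_div_powr_integrable) auto
    show "g integrable_on {0..3 * pi / 2}"
      unfolding g_def by (intro integrable_add integrable_on_powr_from_0) auto
    show "norm (cos t / t powr (u n)) \<le> g t" if t: "t \<in> {0..3 * pi / 2}" for n t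
    proof (cases "t = 0")
      case False
      have "norm (cos t / t powr (u n)) \<le> t powr (- u n)"
        by (simp add: powr_minus divide_simps abs_cos_le_one)
      also have "\<dots> \<le> g t"
      proof (cases "t \<le> 1")
        case True
        then have "t powr (- u n) \<le> t powr (-(1/2))"
          using t False u[rule_format, of n] by (intro powr_mono') auto
        then show ?thesis by (simp add: g_def)
      next
        case False
        then have "t powr (- u n) \<le> t powr 0"
          using u[rule_format, of n] by (intro powr_mono) auto
        also have "\<dots> \<le> g t" using False by (simp add: g_def)
        finally show ?thesis .
      qed
      finally show ?thesis .
    qed (simp add: g_def)
    show "(\<lambda>n. cos t / t powr (u n)) \<longlonglongrightarrow> cos t / t powr a"
      if "t \<in> {0..3 * pi / 2}" for t
      using that lim by (cases "t = 0") (auto intro!: tendsto_intros)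
  qed
  then show "((\<lambda>a. integral {0..3 * pi / 2} (\<lambda>t. cos t / t powr a)) \<circ> u)
      \<longlonglongrightarrow> integral {0..3 * pi / 2} (\<lambda>t. cos t / t powr a)"
    by (simp add: o_def)
qed

lemma cos_integral_Icc:
  fixes u v :: real
  assumes "u \<le> v"
  shows "(cos has_integral (sin v - sin u)) {u..v}"
  using assms by (intro fundamental_theorem_of_calculus)
    (auto intro!: derivative_eq_intros simp flip: has_real_derivative_iff_has_vector_derivative)

lemma sin_three_halves_pi: "sin (3 * pi / 2) = -1"
proof -
  have "sin (pi / 2 + pi) = -1" by (subst sin_periodic_pi) simp
  moreover have "pi / 2 + pi = 3 * pi / 2" by simp
  ultimately show ?thesis by (simp only:)
qed

lemma cos_div_sqrt_integral_pos:
  "integral {0..3 * pi / 2} (\<lambda>t. cos t / t powr (1/2)) > 0"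
proof -
  let ?f = "\<lambda>t::real. cos t / t powr (1/2)"
  define p :: real where "p = pi / 2"
  have p: "p > 0" by (simp add: p_def)
  have pb: "1.57 < p" "p < 1.58"
    using pi_approx by (simp_all add: p_def)
  have i1: "?f integrable_on {0..p}" "?f integrable_on {0..3 * pi / 2}"
    using p by (intro cos_div_powr_integrable; simp)+
  have i2: "?f integrable_on {p..3 * pi / 2}"
    using i1(2) by (rule integrable_subinterval_real) (auto simp: p_def)
  have split: "integral {0..3 * pi / 2} ?f = integral {0..p} ?f + integral {p..3 * pi / 2} ?f"
    by (rule Henstock_Kurzweil_Integration.integral_combine[symmetric, OF _ _ i1(2)])
      (auto simp: p_def)
  have lo: "((\<lambda>t. t powr (-(1/2)) - (1/2) * t powr (3/2)) has_integral
      (p powr (1/2) / (1/2) - (1/2) * (p powr (5/2) / (5/2)))) {0..p}"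
    using p has_integral_powr_from_0[of "-(1/2)" p] has_integral_powr_from_0[of "3/2" p]
    by (intro has_integral_diff has_integral_mult_right) auto
  have "p powr (1/2) / (1/2) - (1/2) * (p powr (5/2) / (5/2)) \<le> integral {0..p} ?f"
  proof (rule has_integral_le[OF lo integrable_integral[OF i1(1)]])
    fix t assume t: "t \<in> {0..p}"
    show "t powr (-(1/2)) - (1/2) * t powr (3/2) \<le> ?f t"
    proof (cases "t = 0")
      case False
      then have t0: "t > 0" using t by simp
      have eq: "t powr (3/2) = t\<^sup>2 * t powr (-(1/2))"
        using t0 powr_add[of t 2 "-(1/2)"] by simp
      have "1 - t\<^sup>2 / 2 \<le> cos t"
      proof -
        have "(sin (t / 2))\<^sup>2 \<le> (t / 2)\<^sup>2"
          using abs_sin_x_le_abs_x[of "t / 2"] by (simp only: abs_le_square_iff)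
        then show ?thesis using cos_double_sin[of "t / 2"] by (simp add: power_divide)
      qed
      then have "(1 - t\<^sup>2 / 2) * t powr (-(1/2)) \<le> cos t * t powr (-(1/2))"
        by (rule mult_right_mono) simp
      then show ?thesis unfolding eq by (simp add: powr_minus_divide algebra_simps)
    qed simp
  qed
  moreover have "-2 * p powr (-(1/2)) \<le> integral {p..3 * pi / 2} ?f"
  proof (rule has_integral_le[OF _ integrable_integral[OF i2]])
    have "((\<lambda>t. cos t * p powr (-(1/2))) has_integral
        (sin (3 * pi / 2) - sin p) * p powr (-(1/2))) {p..3 * pi / 2}"
      by (intro has_integral_mult_left cos_integral_Icc) (simp add: p_def)
    then show "((\<lambda>t. cos t * p powr (-(1/2))) has_integral -2 * p powr (-(1/2))) {p..3 * pi / 2}"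
      by (simp add: sin_three_halves_pi p_def)
    fix t assume t: "t \<in> {p..3 * pi / 2}"
    have "cos (t - pi) \<ge> 0"
      using t by (intro cos_ge_zero) (auto simp: p_def)
    then have "cos t \<le> 0" by simp
    moreover have "t powr (-(1/2)) \<le> p powr (-(1/2))"
      using t p by (intro powr_mono2') auto
    ultimately have "cos t * p powr (-(1/2)) \<le> cos t * t powr (-(1/2))"
      by (intro mult_left_mono_neg)
    then show "cos t * p powr (-(1/2)) \<le> ?f t" by (simp add: powr_minus_divide)
  qed
  moreover have "p powr (1/2) / (1/2) - (1/2) * (p powr (5/2) / (5/2)) - 2 * p powr (-(1/2)) > 0"
  proof -
    have e1: "p powr (1/2) = p * p powr (-(1/2))"
      using p powr_add[of p 1 "-(1/2)"] by simp
    have e2: "p powr (5/2) = p ^ 3 * p powr (-(1/2))"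
      using p powr_add[of p 3 "-(1/2)"] by simp
    have "p ^ 3 \<le> 1.58 ^ 3" using pb by (intro power_mono) auto
    then have "2 * p - p ^ 3 / 5 - 2 > 0" using pb by (simp add: power3_eq_cube)
    then have "(2 * p - p ^ 3 / 5 - 2) * p powr (-(1/2)) > 0" using p by simp
    then show ?thesis unfolding e1 e2 by (simp add: algebra_simps)
  qed
  ultimately show ?thesis unfolding split by linarith
qed

lemma ex1_alpha0:
  "\<exists>!a::real. 0 < a \<and> a < 1 \<and> integral {0..3 * pi / 2} (\<lambda>t. cos t / t powr a) = 0"
proof -
  let ?F = "\<lambda>a::real. integral {0..3 * pi / 2} (\<lambda>t. cos t / t powr a)"
  have "?F 0 = integral {0..3 * pi / 2} cos"
    by (intro integral_spike[of "{0}"]) auto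
  also have "\<dots> = -1"
    using cos_integral_Icc[of 0 "3 * pi / 2"] by (simp add: sin_three_halves_pi integral_unique)
  finally have F0: "?F 0 = -1" .
  have "\<exists>a\<ge>0. a \<le> 1/2 \<and> ?F a = 0"
    using cos_div_sqrt_integral_pos F0
    by (intro IVT' cos_div_powr_integral_continuous) auto
  then obtain a where a: "0 \<le> a" "a \<le> 1/2" "?F a = 0" by blast
  moreover have "a \<noteq> 0" using a F0 by auto
  ultimately have a': "0 < a \<and> a < 1 \<and> ?F a = 0" by auto
  show ?thesis
  proof (rule ex1I[of _ a])
    show "0 < a \<and> a < 1 \<and> ?F a = 0" by (fact a')
    fix b assume "0 < b \<and> b < 1 \<and> ?F b = 0"
    then show "b = a"
      using alpha0_root_unique_aux[of a b] alpha0_root_unique_aux[of b a] a'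
      by (meson linorder_neqE_linordered_idom)
  qed
qed

lemma alpha0_root:
  "0 < alpha0" "alpha0 < 1" "integral {0..3 * pi / 2} (\<lambda>t. cos t / t powr alpha0) = 0"
  using theI'[OF ex1_alpha0] unfolding alpha0_def by auto

end

theory Submission
  imports Defs
begin

text \<open>
  Laplace's integral writes \<open>C\<^sub>k(x) / C\<^sub>k(1)\<close> as an average of \<open>Re (z ^ k)\<close> over points \<open>z\<close> of the
  open unit disc (\<open>gegenbauer_ratio_laplace_integral\<close>), whatever the order of the polynomials.
  Hence it is enough that \<open>Re (\<Sum>k\<le>n. a\<^sub>k z\<^sup>k) > 0\<close> in the disc, and by the maximum principle that
  \<open>\<Sum>k\<le>n. a\<^sub>k cos (k \<theta>) \<ge> 0\<close> for all real \<open>\<theta>\<close> (\<open>Re_polynomial_pos_in_disc\<close>).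

  All coefficients are positive, so the hypothesis forces \<open>k > \<alpha>\<close> for \<open>1 \<le> k \<le> n\<close>, the two factors
  involving \<open>b\<close> and \<open>c\<close> can be dropped, and what remains is \<open>k a\<^sub>k \<le> (k - \<alpha>\<^sub>0) a\<^sub>k\<^sub>-\<^sub>1\<close>. With
  \<open>\<mu> = 1 - \<alpha>\<^sub>0\<close> and \<open>d\<^sub>k = (\<mu>)\<^sub>k / k!\<close> this says that \<open>a\<^sub>k / d\<^sub>k\<close> decreases. Summation by parts
  reduces the cosine sum to the extremal coefficients \<open>d\<^sub>k\<close> (\<open>cos_sum_nonneg\<close>).

  For these the constant \<open>\<alpha>\<^sub>0\<close> is sharp, and the sum must be compared with an integral that
  vanishes. Since \<open>2 sin (\<theta>/2) cos (k \<theta>) = \<theta> \<integral> cos (u \<theta>) du\<close> over \<open>[k - 1/2, k + 1/2]\<close>, the sum is,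
  up to a positive factor, an integral of a decreasing step function against \<open>cos (u \<theta>)\<close>. For
  upper limits beyond \<open>\<pi> / (2 \<theta>)\<close> that integral is smallest at \<open>y = 3 \<pi> / (2 \<theta>)\<close>, where integration
  by parts turns it into \<open>\<theta> \<integral> L(u) sin (u \<theta>) du\<close> over \<open>[0, y]\<close>; here \<open>L\<close> interpolates the partial sums of the
  \<open>d\<^sub>k\<close> linearly between the half-integers (\<open>cum_interp\<close>). The definition of \<open>\<alpha>\<^sub>0\<close> says exactly
  that the integral of \<open>u\<^sup>\<mu> sin (u \<theta>)\<close> over the same interval is zero (\<open>powr_sin_integral_zero\<close>), so any
  multiple \<open>\<kappa> u\<^sup>\<mu>\<close> may be subtracted from \<open>L\<close>. Because \<open>\<mu> \<ge> 1/2\<close>, the quotient \<open>L(u) / u\<^sup>\<mu>\<close>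
  decreases from \<open>u = 1/2\<close> on (\<open>cum_interp_ratio_decreasing\<close>). If \<open>\<kappa>\<close> is its value at \<open>\<pi> / \<theta>\<close>, then
  \<open>L - \<kappa> u\<^sup>\<mu>\<close> and the sine change sign together and the integrand is nonnegative, except near \<open>0\<close>. The
  small negative part there is outweighed by the positive part on \<open>[0, 1]\<close>, as one sees by
  replacing the sine by the polynomial weight \<open>u - u\<^sup>3\<close> (\<open>cum_interp_sin_integral_nonneg\<close>).
  The weight serves as long as \<open>\<theta>\<^sup>2 \<le> 6\<close>; for \<open>\<theta>\<close> near \<open>\<pi>\<close> a crude summation by parts is enough.
\<close>

section \<open>The extremal coefficients and their cosine sums\<close>

text \<open>
  The coefficients of the binomial series of \<open>(1 - z) powr (-\<mu>)\<close>. The partial sums of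
  \<open>bcoeff \<mu>\<close> are the numbers \<open>bcoeff (\<mu> + 1)\<close>, see \<open>bcoeff_shift_Suc\<close>.
\<close>
definition bcoeff :: "real \<Rightarrow> nat \<Rightarrow> real" where
  "bcoeff \<mu> k = pochhammer \<mu> k / fact k"

lemma bcoeff_0 [simp]: "bcoeff \<mu> 0 = 1"
  by (simp add: bcoeff_def)

lemma bcoeff_Suc: "bcoeff \<mu> (Suc k) = bcoeff \<mu> k * (\<mu> + real k) / (real k + 1)"
  by (simp add: bcoeff_def pochhammer_Suc)

lemma bcoeff_Suc_shift: "bcoeff \<mu> (Suc k) = \<mu> * bcoeff (\<mu> + 1) k / (real k + 1)"
  by (simp add: bcoeff_def pochhammer_rec)

lemma bcoeff_shift_Suc: "bcoeff (\<mu> + 1) (Suc k) = bcoeff (\<mu> + 1) k + bcoeff \<mu> (Suc k)"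
  unfolding bcoeff_Suc[of "\<mu> + 1"] bcoeff_Suc_shift[of \<mu>] by (simp add: field_simps)

lemma bcoeff_pos: "\<mu> > 0 \<Longrightarrow> bcoeff \<mu> k > 0"
  by (simp add: bcoeff_def pochhammer_pos)

lemma bcoeff_Suc_le:
  assumes "0 < \<mu>" "\<mu> \<le> 1"
  shows "bcoeff \<mu> (Suc k) \<le> bcoeff \<mu> k"
  using assms bcoeff_pos[of \<mu> k] by (simp add: bcoeff_Suc field_simps)

text \<open>
  Abel's inequality: with decreasing nonnegative weights, a lower bound on the partial sums has to
  be multiplied by the first weight only. The induction carries the last weight along, because \<open>w j\<close> times the shifted partial
  sum is what has to be compared with the next step.
\<close>
lemma abel_sum_lower_bound:
  fixes w t :: "nat \<Rightarrow> real"
  assumes mn: "m \<le> n"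
    and partial: "\<And>j. m \<le> j \<Longrightarrow> j \<le> n \<Longrightarrow> (\<Sum>k=m..j. t k) \<ge> - C"
    and decr: "\<And>k. m \<le> k \<Longrightarrow> k < n \<Longrightarrow> w (Suc k) \<le> w k"
    and nonneg: "w n \<ge> 0"
  shows "(\<Sum>k=m..n. w k * t k) \<ge> - C * w m"
proof -
  have "w j * ((\<Sum>k=m..j. t k) + C) \<le> (\<Sum>k=m..j. w k * t k) + C * w m" if "m \<le> j" "j \<le> n" for j
    using that
  proof (induction rule: dec_induct)
    case base
    then show ?case by (simp add: algebra_simps)
  next
    case (step j)
    have "w (Suc j) * ((\<Sum>k=m..Suc j. t k) + C)
        = w (Suc j) * ((\<Sum>k=m..j. t k) + C) + w (Suc j) * t (Suc j)"
      using step.hyps by (simp add: algebra_simps)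
    also have "w (Suc j) * ((\<Sum>k=m..j. t k) + C) \<le> w j * ((\<Sum>k=m..j. t k) + C)"
      using step partial[of j] decr[of j] by (intro mult_right_mono) auto
    also have "\<dots> \<le> (\<Sum>k=m..j. w k * t k) + C * w m"
      using step by simp
    finally show ?case using step.hyps by (simp add: algebra_simps)
  qed
  from this[OF mn order_refl] have
    "w n * ((\<Sum>k=m..n. t k) + C) \<le> (\<Sum>k=m..n. w k * t k) + C * w m" .
  moreover have "0 \<le> w n * ((\<Sum>k=m..n. t k) + C)"
    using nonneg partial[OF mn order_refl] by simp
  ultimately show ?thesis by simp
qed

definition cos_sum :: "real \<Rightarrow> nat \<Rightarrow> real \<Rightarrow> real" where
  "cos_sum \<mu> n \<theta> = (\<Sum>k=0..n. bcoeff \<mu> k * cos (real k * \<theta>))"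

lemma two_sin_half_cos:
  fixes \<theta> :: real
  shows "2 * sin (\<theta> / 2) * cos (real k * \<theta>) = sin ((real k + 1/2) * \<theta>) - sin ((real k - 1/2) * \<theta>)"
  by (simp add: algebra_simps sin_add sin_diff)

lemma cos_sum_Suc: "cos_sum \<mu> (Suc n) \<theta> = cos_sum \<mu> n \<theta> + bcoeff \<mu> (Suc n) * cos (real (Suc n) * \<theta>)"
  by (simp add: cos_sum_def)

lemma cos_sum_tail:
  assumes "m \<le> n"
  shows "cos_sum \<mu> n \<theta> = cos_sum \<mu> m \<theta> + (\<Sum>k=Suc m..n. bcoeff \<mu> k * cos (real k * \<theta>))"
  using assms by (induction rule: dec_induct) (simp_all add: cos_sum_Suc)

text \<open>
  After multiplication by \<open>2 sin (\<theta>/2)\<close> the cosines telescope to differences of sines, so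
  a tail can lower the sum only by as much as a sine can still drop to \<open>-1\<close>.
\<close>
lemma cos_sum_tail_lower_bound:
  assumes mu: "0 < \<mu>" "\<mu> \<le> 1" and mn: "m \<le> n"
  shows "2 * sin (\<theta> / 2) * cos_sum \<mu> n \<theta> \<ge>
    2 * sin (\<theta> / 2) * cos_sum \<mu> m \<theta> - bcoeff \<mu> (Suc m) * (1 + sin ((real m + 1/2) * \<theta>))"
proof (cases "m = n")
  case True
  have "sin ((real m + 1/2) * \<theta>) \<ge> -1" by simp
  then have "bcoeff \<mu> (Suc m) * (1 + sin ((real m + 1/2) * \<theta>)) \<ge> 0"
    using bcoeff_pos[of \<mu> "Suc m"] mu by (intro mult_nonneg_nonneg) linarith+
  then show ?thesis by (simp add: True)
next
  case False
  define t where "t k = 2 * sin (\<theta> / 2) * cos (real k * \<theta>)" for k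
  have t_eq: "t k = sin ((real k + 1/2) * \<theta>) - sin ((real k - 1/2) * \<theta>)" for k
    unfolding t_def by (rule two_sin_half_cos)
  have "(\<Sum>k=Suc m..n. bcoeff \<mu> k * t k) \<ge> - (1 + sin ((real m + 1/2) * \<theta>)) * bcoeff \<mu> (Suc m)"
  proof (rule abel_sum_lower_bound)
    show "Suc m \<le> n" using False mn by simp
    fix j assume "Suc m \<le> j" "j \<le> n"
    then have "(\<Sum>k=Suc m..j. t k) = sin ((real j + 1/2) * \<theta>) - sin ((real m + 1/2) * \<theta>)"
    proof (induction rule: dec_induct)
      case base
      show ?case unfolding t_eq by (simp add: add.commute)
    next
      case (step i)
      have "real (Suc i) - 1/2 = real i + 1/2" by simp
      then have "t (Suc i) = sin ((real (Suc i) + 1/2) * \<theta>) - sin ((real i + 1/2) * \<theta>)"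
        unfolding t_eq by (simp only:)
      then show ?case using step by simp
    qed
    moreover have "sin ((real j + 1/2) * \<theta>) \<ge> -1" by simp
    ultimately show "(\<Sum>k=Suc m..j. t k) \<ge> - (1 + sin ((real m + 1/2) * \<theta>))" by linarith
  next
    show "bcoeff \<mu> n \<ge> 0" using bcoeff_pos[of \<mu> n] mu by simp
  qed (use bcoeff_Suc_le mu in auto)
  moreover have "(\<Sum>k=Suc m..n. bcoeff \<mu> k * t k)
      = 2 * sin (\<theta> / 2) * (\<Sum>k=Suc m..n. bcoeff \<mu> k * cos (real k * \<theta>))"
    by (simp add: t_def sum_distrib_left mult_ac)
  ultimately show ?thesis
    using cos_sum_tail[OF mn, of \<mu> \<theta>] by (simp add: algebra_simps)
qed

text \<open>
  The tail bound from \<open>m = 0\<close> leaves \<open>(2 - \<mu>) sin (\<theta>/2) - \<mu>\<close>, which is nonnegative at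
  \<open>\<theta> = 2 \<pi> / 3\<close> up to \<open>\<mu> = 0.928...\<close>; the value \<open>23/25\<close> is what \<open>alpha0_bounds\<close> will supply.
\<close>
lemma cos_sum_nonneg_near_pi:
  assumes mu: "0 < \<mu>" "\<mu> \<le> 23/25" and th: "2 * pi / 3 \<le> \<theta>" "\<theta> \<le> pi"
  shows "cos_sum \<mu> n \<theta> \<ge> 0"
proof -
  have "sin (pi / 3) \<le> sin (\<theta> / 2)"
    using th by (intro sin_monotone_2pi_le) auto
  moreover have "sqrt 3 \<ge> 1.732" by (rule real_le_rsqrt) (simp add: power2_eq_square)
  ultimately have s: "sin (\<theta> / 2) \<ge> 0.866" by (simp add: sin_60)
  have "0.866 * (2 - \<mu>) - \<mu> \<le> sin (\<theta> / 2) * (2 - \<mu>) - \<mu>"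
    using s mu by (intro diff_right_mono mult_right_mono) auto
  then have "0 \<le> sin (\<theta> / 2) * (2 - \<mu>) - \<mu>"
    using mu by simp
  also have "\<dots> \<le> 2 * sin (\<theta> / 2) * cos_sum \<mu> n \<theta>"
    using cos_sum_tail_lower_bound[of \<mu> 0 n \<theta>] mu by (simp add: cos_sum_def bcoeff_Suc algebra_simps)
  finally show ?thesis using s by (simp add: zero_le_mult_iff)
qed

section \<open>The interpolated partial sums\<close>

text \<open>
  The continuous function that is linear between half-integers, takes the value
  \<open>\<Sum>j\<le>k. bcoeff \<mu> j\<close> at \<open>k + 1/2\<close>, and vanishes at \<open>0\<close>. The slope is \<open>2\<close> on \<open>[0, 1/2]\<close> since the
  coefficient \<open>1\<close> of the constant term belongs to an interval symmetric about the origin, of which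
  only one half is used.
\<close>
definition cum_interp :: "real \<Rightarrow> real \<Rightarrow> real" where
  "cum_interp \<mu> u = (if u < 1/2 then 2 * u
     else let k = nat \<lfloor>u - 1/2\<rfloor> in bcoeff (\<mu> + 1) k + bcoeff \<mu> (Suc k) * (u - (real k + 1/2)))"

lemma cum_interp_start:
  assumes "u \<le> 1/2"
  shows "cum_interp \<mu> u = 2 * u"
proof (cases "u = 1/2")
  case True
  show ?thesis unfolding True by (simp add: cum_interp_def)
next
  case False
  then show ?thesis using assms by (simp add: cum_interp_def)
qed

lemma cum_interp_piece:
  assumes "real k + 1/2 \<le> u" "u \<le> real k + 3/2"
  shows "cum_interp \<mu> u = bcoeff (\<mu> + 1) k + bcoeff \<mu> (Suc k) * (u - (real k + 1/2))"
proof (cases "u = real k + 3/2")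
  case True
  have "\<lfloor>u - 1/2\<rfloor> = int (Suc k)" using True by (simp add: floor_eq_iff)
  then have "nat \<lfloor>u - 1/2\<rfloor> = Suc k" by simp
  then show ?thesis
    by (simp only: cum_interp_def Let_def) (simp add: True bcoeff_shift_Suc)
next
  case False
  have "\<lfloor>u - 1/2\<rfloor> = int k" using False assms by (simp add: floor_eq_iff)
  then have "nat \<lfloor>u - 1/2\<rfloor> = k" by simp
  then show ?thesis using assms
    by (simp only: cum_interp_def Let_def) simp
qed

lemma half_integer_piece:
  assumes "1/2 \<le> (u::real)"
  obtains k where "real k + 1/2 \<le> u" "u \<le> real k + 3/2"
proof
  have "0 \<le> \<lfloor>u - 1/2\<rfloor>" using assms by simp
  then have "real (nat \<lfloor>u - 1/2\<rfloor>) = of_int \<lfloor>u - 1/2\<rfloor>" by simp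
  then show "real (nat \<lfloor>u - 1/2\<rfloor>) + 1/2 \<le> u" "u \<le> real (nat \<lfloor>u - 1/2\<rfloor>) + 3/2"
    by linarith+
qed

text \<open>
  Bernoulli's inequality for exponents between \<open>0\<close> and \<open>1\<close>.
\<close>
lemma powr_le_linear:
  fixes x p :: real
  assumes "0 < x" "0 \<le> p" "p \<le> 1"
  shows "x powr p \<le> 1 + p * (x - 1)"
  using Youngs_inequality_0[of p "1 - p" x 1] assms by (simp add: algebra_simps)

text \<open>
  On a linear piece with slope \<open>d\<close> the quotient decreases up to \<open>v\<close> if \<open>d v \<le> \<mu> L(v)\<close>, by Bernoulli's
  inequality applied to \<open>u / v\<close>. At the right end of a piece, the worst point, this condition
  reads \<open>\<mu> \<ge> 1/2\<close>.
\<close>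
lemma cum_interp_ratio_decreasing_piece:
  assumes mu: "1/2 \<le> \<mu>" "\<mu> \<le> 1"
    and k: "real k + 1/2 \<le> u" "u \<le> v" "v \<le> real k + 3/2"
  shows "cum_interp \<mu> v * u powr \<mu> \<le> cum_interp \<mu> u * v powr \<mu>"
proof -
  have v: "v > 0" "u > 0" using k by auto
  define s d where "s = bcoeff (\<mu> + 1) k" and "d = bcoeff \<mu> (Suc k)"
  have d: "d * (real k + 1) = \<mu> * s" by (simp add: d_def s_def bcoeff_Suc_shift)
  have pos: "d > 0" using mu unfolding d_def by (intro bcoeff_pos) auto
  have Lv: "cum_interp \<mu> v = s + d * (v - (real k + 1/2))"
    using k unfolding s_def d_def by (intro cum_interp_piece) auto
  have Lu: "cum_interp \<mu> u = cum_interp \<mu> v - d * (v - u)"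
    using cum_interp_piece[of k u \<mu>] k unfolding Lv s_def d_def by (simp add: algebra_simps)
  have eq: "\<mu> * cum_interp \<mu> v - d * v = d * (real k + 1 - \<mu> * (real k + 1/2) - (1 - \<mu>) * v)"
    unfolding Lv using d by (simp add: algebra_simps)
  have "(1 - \<mu>) * v \<le> (1 - \<mu>) * (real k + 3/2)"
    using mu k by (intro mult_left_mono) auto
  moreover have "real k + 1 - \<mu> * (real k + 1/2) - (1 - \<mu>) * (real k + 3/2) = \<mu> - 1/2"
    by (simp add: field_simps)
  ultimately have "0 \<le> real k + 1 - \<mu> * (real k + 1/2) - (1 - \<mu>) * v"
    using mu by linarith
  then have "0 \<le> d * (real k + 1 - \<mu> * (real k + 1/2) - (1 - \<mu>) * v)"
    using pos by (intro mult_nonneg_nonneg) auto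
  then have slope: "d * v \<le> \<mu> * cum_interp \<mu> v"
    using eq by linarith
  have Lpos: "cum_interp \<mu> v \<ge> 0"
    using bcoeff_pos[of "\<mu> + 1" k] mu pos k unfolding Lv s_def by simp
  have "(u / v) powr \<mu> \<le> 1 + \<mu> * (u / v - 1)"
    using v mu by (intro powr_le_linear) auto
  then have "cum_interp \<mu> v * (u / v) powr \<mu> \<le> cum_interp \<mu> v * (1 + \<mu> * (u / v - 1))"
    using Lpos by (rule mult_left_mono)
  also have "\<dots> = cum_interp \<mu> v - \<mu> * cum_interp \<mu> v * ((v - u) / v)"
    using v by (simp add: field_simps)
  also have "\<dots> \<le> cum_interp \<mu> v - d * v * ((v - u) / v)"
    using slope k v by (intro diff_left_mono mult_right_mono) auto
  also have "\<dots> = cum_interp \<mu> u" using v by (simp add: Lu)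
  finally show ?thesis
    using v by (simp add: powr_divide field_simps)
qed

lemma cum_interp_ratio_decreasing:
  assumes mu: "1/2 \<le> \<mu>" "\<mu> \<le> 1" and uv: "1/2 \<le> u" "u \<le> v"
  shows "cum_interp \<mu> v / v powr \<mu> \<le> cum_interp \<mu> u / u powr \<mu>"
proof -
  define h where "h x = cum_interp \<mu> x / x powr \<mu>" for x
  have piece: "h y \<le> h x" if "real k + 1/2 \<le> x" "x \<le> y" "y \<le> real k + 3/2" for k x y
    using cum_interp_ratio_decreasing_piece[OF mu that] that
    by (simp add: h_def divide_simps mult_ac)
  obtain i where i: "real i + 1/2 \<le> u" "u \<le> real i + 3/2"
    using half_integer_piece uv by blast
  obtain j where j: "real j + 1/2 \<le> v" "v \<le> real j + 3/2"
    using half_integer_piece uv by (metis order_trans)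
  show ?thesis
  proof (cases "v \<le> real i + 3/2")
    case True
    then show ?thesis using piece[of i u v] i uv by (simp add: h_def)
  next
    case False
    then have "Suc i \<le> j" using j by linarith
    then have "h (real j + 1/2) \<le> h (real (Suc i) + 1/2)"
    proof (induction rule: dec_induct)
      case (step k)
      then show ?case using piece[of k "real k + 1/2" "real (Suc k) + 1/2"] by simp
    qed simp
    also have "\<dots> \<le> h u" using piece[of i u "real (Suc i) + 1/2"] i by simp
    finally have "h (real j + 1/2) \<le> h u" .
    moreover have "h v \<le> h (real j + 1/2)" using piece[of j "real j + 1/2" v] j by simp
    ultimately show ?thesis by (simp add: h_def)
  qed
qed

section \<open>The constant and the vanishing integral\<close>

text \<open>
  On \<open>[0, \<pi>/2]\<close> the cosine is bounded by \<open>1\<close>, and on \<open>[\<pi>/2, 3\<pi>/2]\<close>, where it is nonpositive, the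
  power is bounded below by its last value. At the exponent \<open>2/25\<close> the second
  part outweighs the first.
\<close>
lemma cos_div_powr_integral_neg:
  "integral {0..3 * pi / 2} (\<lambda>t. cos t / t powr (2/25)) < 0"
proof -
  let ?f = "\<lambda>t::real. cos t / t powr (2/25)"
  define p :: real where "p = pi / 2"
  have p: "p > 0" "p < 1.571" using pi_approx by (simp_all add: p_def)
  have i1: "?f integrable_on {0..p}" "?f integrable_on {0..3 * p}"
    using p by (intro cos_div_powr_integrable; simp)+
  have i2: "?f integrable_on {p..3 * p}"
    using i1(2) by (rule integrable_subinterval_real) (use p in auto)
  have split: "integral {0..3 * p} ?f = integral {0..p} ?f + integral {p..3 * p} ?f"
    by (rule Henstock_Kurzweil_Integration.integral_combine[symmetric, OF _ _ i1(2)])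
      (use p in auto)
  have "integral {0..p} ?f \<le> p powr (23/25) / (23/25)"
  proof (rule has_integral_le[OF integrable_integral[OF i1(1)]])
    show "((\<lambda>t. t powr (-(2/25))) has_integral p powr (23/25) / (23/25)) {0..p}"
      using has_integral_powr_from_0[of "-(2/25)" p] p by simp
    show "?f t \<le> t powr (-(2/25))" if "t \<in> {0..p}" for t
      using cos_le_one[of t] by (simp add: powr_minus_divide divide_right_mono)
  qed
  moreover have "integral {p..3 * p} ?f \<le> -2 * (3 * p) powr (-(2/25))"
  proof (rule has_integral_le[OF integrable_integral[OF i2]])
    have "((\<lambda>t. cos t * (3 * p) powr (-(2/25))) has_integral
        (sin (3 * pi / 2) - sin p) * (3 * p) powr (-(2/25))) {p..3 * pi / 2}"
      by (intro has_integral_mult_left cos_integral_Icc) (simp add: p_def)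
    then show "((\<lambda>t. cos t * (3 * p) powr (-(2/25))) has_integral -2 * (3 * p) powr (-(2/25))) {p..3 * p}"
      by (simp add: sin_three_halves_pi p_def)
    fix t assume t: "t \<in> {p..3 * p}"
    have "cos (t - pi) \<ge> 0" using t by (intro cos_ge_zero) (auto simp: p_def)
    then have "cos t \<le> 0" by simp
    moreover have "(3 * p) powr (-(2/25)) \<le> t powr (-(2/25))"
      using t p by (intro powr_mono2') auto
    ultimately have "cos t * t powr (-(2/25)) \<le> cos t * (3 * p) powr (-(2/25))"
      by (intro mult_left_mono_neg)
    then show "?f t \<le> cos t * (3 * p) powr (-(2/25))" by (simp add: powr_minus_divide)
  qed
  moreover have "p powr (23/25) / (23/25) - 2 * (3 * p) powr (-(2/25)) < 0"
  proof -
    have e1: "p powr (23/25) = p * p powr (-(2/25))"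
      using p powr_add[of p 1 "-(2/25)"] by simp
    have e2: "(3 * p) powr (-(2/25)) = 3 powr (-(2/25)) * p powr (-(2/25))"
      using p by (simp add: powr_mult)
    have "(3::real) powr (2/25) \<le> 29/25" using powr_le_linear[of 3 "2/25"] by simp
    then have "25/29 \<le> 1 / (3::real) powr (2/25)" by (simp add: field_simps)
    also have "\<dots> = 3 powr (-(2/25))" by (simp add: powr_minus_divide)
    finally have "p / (23/25) - 2 * 3 powr (-(2/25)) < 0" using p by simp
    then have "(p / (23/25) - 2 * 3 powr (-(2/25))) * p powr (-(2/25)) < 0"
      using p by (intro mult_neg_pos) auto
    then show ?thesis unfolding e1 e2 by (simp add: algebra_simps)
  qed
  moreover have "3 * pi / 2 = 3 * p" by (simp add: p_def)
  ultimately show ?thesis by (simp only: split)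
qed

text \<open>
  The upper bound makes \<open>L(u) / u\<^sup>\<mu>\<close> monotone; the lower bound settles angles near \<open>\<pi>\<close>.
\<close>
lemma alpha0_bounds: "2/25 \<le> alpha0" "alpha0 \<le> 1/2"
proof -
  let ?F = "\<lambda>a::real. integral {0..3 * pi / 2} (\<lambda>t. cos t / t powr a)"
  have "\<exists>a\<ge>2/25. a \<le> 1/2 \<and> ?F a = 0"
    using cos_div_sqrt_integral_pos cos_div_powr_integral_neg
    by (intro IVT' continuous_on_subset[OF cos_div_powr_integral_continuous]) auto
  then obtain a where a: "2/25 \<le> a" "a \<le> 1/2" "?F a = 0" by blast
  then have "0 < a \<and> a < 1 \<and> ?F a = 0" by simp
  then have "alpha0 = a" using ex1_alpha0 alpha0_root by blast
  with a show "2/25 \<le> alpha0" "alpha0 \<le> 1/2" by simp_all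
qed

lemma cos_three_halves_pi: "cos (3 * pi / 2) = 0"
proof -
  have "cos (pi / 2 + pi) = 0" by (subst cos_periodic_pi) simp
  moreover have "pi / 2 + pi = 3 * pi / 2" by simp
  ultimately show ?thesis by (simp only:)
qed

text \<open>
  The defining equation of \<open>\<alpha>\<^sub>0\<close>, integrated by parts and rescaled. The boundary term vanishes
  because the cosine is \<open>0\<close> at \<open>3\<pi>/2\<close>.
\<close>
lemma powr_sin_integral_zero:
  assumes th: "\<theta> > 0"
  shows "((\<lambda>u. u powr (1 - alpha0) * sin (u * \<theta>)) has_integral 0) {0..3 * pi / (2 * \<theta>)}"
proof -
  define \<mu> where "\<mu> = 1 - alpha0"
  have mu: "\<mu> > 0" using alpha0_root by (simp add: \<mu>_def)
  have "((\<lambda>t. \<mu> * (cos t / t powr alpha0) - t powr \<mu> * sin t) has_integral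
      (3 * pi / 2) powr \<mu> * cos (3 * pi / 2) - 0 powr \<mu> * cos 0) {0..3 * pi / 2}"
  proof (rule fundamental_theorem_of_calculus_interior)
    show "continuous_on {0..3 * pi / 2} (\<lambda>t. t powr \<mu> * cos t)"
      using mu by (intro continuous_intros continuous_on_powr') auto
    fix t assume t: "t \<in> {0<..<3 * pi / 2}"
    then have "t powr (\<mu> - 1) = 1 / t powr alpha0" by (simp add: \<mu>_def powr_minus_divide)
    then show "((\<lambda>t. t powr \<mu> * cos t) has_vector_derivative
        (\<mu> * (cos t / t powr alpha0) - t powr \<mu> * sin t)) (at t)"
      using t by (auto intro!: derivative_eq_intros
        simp: algebra_simps simp flip: has_real_derivative_iff_has_vector_derivative)
  qed simp
  then have 1: "((\<lambda>t. \<mu> * (cos t / t powr alpha0) - t powr \<mu> * sin t) has_integral 0) {0..3 * pi / 2}"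
    using mu by (simp add: cos_three_halves_pi)
  have "((\<lambda>t. cos t / t powr alpha0) has_integral 0) {0..3 * pi / 2}"
    using integrable_integral[OF cos_div_powr_integrable[of alpha0 "3 * pi / 2"]] alpha0_root by simp
  from has_integral_diff[OF has_integral_mult_right[OF this, of \<mu>] 1]
  have "((\<lambda>t. t powr \<mu> * sin t) has_integral 0) {0..3 * pi / 2}" by simp
  from has_integral_stretch_real[OF this, of \<theta>] th
  have "((\<lambda>u. (\<theta> * u) powr \<mu> * sin (\<theta> * u)) has_integral 0) ((\<lambda>x. x / \<theta>) ` {0..3 * pi / 2})"
    by simp
  moreover have "(\<lambda>x. x / \<theta>) ` {0..3 * pi / 2} = {0..3 * pi / (2 * \<theta>)}"
    using th by (simp add: image_divide_atLeastAtMost)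
  ultimately have 2: "((\<lambda>u. \<theta> powr (-\<mu>) * ((\<theta> * u) powr \<mu> * sin (\<theta> * u))) has_integral
      \<theta> powr (-\<mu>) * 0) {0..3 * pi / (2 * \<theta>)}"
    by (intro has_integral_mult_right) simp
  have "((\<lambda>u. u powr \<mu> * sin (u * \<theta>)) has_integral \<theta> powr (-\<mu>) * 0) {0..3 * pi / (2 * \<theta>)}"
    by (rule has_integral_eq[OF _ 2]) (use th in \<open>simp add: powr_mult powr_minus mult.commute\<close>)
  then show ?thesis by (simp add: \<mu>_def)
qed

section \<open>Comparison of the interpolated sums with a power\<close>

lemma line_times_sin_integral:
  fixes s d c \<theta> :: real
  assumes "a \<le> b"
  shows "((\<lambda>u. \<theta>\<^sup>2 * ((s + d * (u - c)) * sin (u * \<theta>))) has_integral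
    (d * sin (b * \<theta>) - \<theta> * (s + d * (b - c)) * cos (b * \<theta>)) -
    (d * sin (a * \<theta>) - \<theta> * (s + d * (a - c)) * cos (a * \<theta>))) {a..b}"
  using assms
  by (intro fundamental_theorem_of_calculus)
    (auto intro!: derivative_eq_intros simp: power2_eq_square algebra_simps
      simp flip: has_real_derivative_iff_has_vector_derivative)

text \<open>
  Integration by parts of the step function that represents the cosine sum, written
  the other way round: the boundary terms at the nodes cancel, so only those at \<open>v\<close> remain.
\<close>
lemma cum_interp_sin_integral:
  assumes v: "real k + 1/2 \<le> v" "v \<le> real k + 3/2"
  shows "((\<lambda>u. \<theta>\<^sup>2 * (cum_interp \<mu> u * sin (u * \<theta>))) has_integral
    2 * sin (\<theta> / 2) * cos_sum \<mu> k \<theta> + bcoeff \<mu> (Suc k) * (sin (v * \<theta>) - sin ((real k + 1/2) * \<theta>))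
      - \<theta> * cum_interp \<mu> v * cos (v * \<theta>)) {0..v}"
proof -
  let ?f = "\<lambda>u. \<theta>\<^sup>2 * (cum_interp \<mu> u * sin (u * \<theta>))"
  have piece: "(?f has_integral bcoeff \<mu> (Suc k) * (sin (v * \<theta>) - sin ((real k + 1/2) * \<theta>))
      - \<theta> * cum_interp \<mu> v * cos (v * \<theta>)
      + \<theta> * bcoeff (\<mu> + 1) k * cos ((real k + 1/2) * \<theta>)) {real k + 1/2..v}"
    if v: "real k + 1/2 \<le> v" "v \<le> real k + 3/2" for k v
  proof -
    have "(?f has_integral
      (bcoeff \<mu> (Suc k) * sin (v * \<theta>) - \<theta> * (bcoeff (\<mu> + 1) k + bcoeff \<mu> (Suc k) * (v - (real k + 1/2))) * cos (v * \<theta>)) -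
      (bcoeff \<mu> (Suc k) * sin ((real k + 1/2) * \<theta>) -
        \<theta> * (bcoeff (\<mu> + 1) k + bcoeff \<mu> (Suc k) * (real k + 1/2 - (real k + 1/2))) * cos ((real k + 1/2) * \<theta>)))
      {real k + 1/2..v}"
      by (rule has_integral_eq[OF _ line_times_sin_integral]) (use v in \<open>auto simp: cum_interp_piece\<close>)
    then show ?thesis
      unfolding cum_interp_piece[OF v, symmetric] by (simp add: algebra_simps)
  qed
  have node: "(?f has_integral 2 * sin (\<theta> / 2) * cos_sum \<mu> k \<theta>
      - \<theta> * bcoeff (\<mu> + 1) k * cos ((real k + 1/2) * \<theta>)) {0..real k + 1/2}" for k
  proof (induction k)
    case 0
    have "(?f has_integral
      (2 * sin (1/2 * \<theta>) - \<theta> * (0 + 2 * (1/2 - 0)) * cos (1/2 * \<theta>)) -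
      (2 * sin (0 * \<theta>) - \<theta> * (0 + 2 * (0 - 0)) * cos (0 * \<theta>))) {0..1/2}"
      by (rule has_integral_eq[OF _ line_times_sin_integral]) (auto simp: cum_interp_start)
    then show ?case by (simp add: cos_sum_def)
  next
    case (Suc k)
    have "cum_interp \<mu> (real k + 3/2) = bcoeff (\<mu> + 1) (Suc k)"
      using cum_interp_piece[of k "real k + 3/2" \<mu>] by (simp add: bcoeff_shift_Suc)
    moreover have "bcoeff \<mu> (Suc k) * (sin ((real k + 3/2) * \<theta>) - sin ((real k + 1/2) * \<theta>))
        = 2 * sin (\<theta> / 2) * (bcoeff \<mu> (Suc k) * cos (real (Suc k) * \<theta>))"
      using two_sin_half_cos[of \<theta> "Suc k"] by (simp add: mult_ac add.commute)
    moreover have "real (Suc k) + 1/2 = real k + 3/2" by simp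
    ultimately show ?case
      using has_integral_combine[OF _ _ Suc piece[of k "real k + 3/2"]]
      by (simp add: cos_sum_Suc algebra_simps)
  qed
  show ?thesis
    using has_integral_combine[OF _ _ node[of k] piece[OF v]] v by (simp add: algebra_simps)
qed

lemma cos_ge_quadratic: "1 - x\<^sup>2 / 2 \<le> cos x" for x :: real
proof -
  have "(sin (x / 2))\<^sup>2 \<le> (x / 2)\<^sup>2"
    using abs_sin_x_le_abs_x[of "x / 2"] by (simp only: abs_le_square_iff)
  then show ?thesis using cos_double_sin[of "x / 2"] by (simp add: power_divide)
qed

lemma sin_ge_cubic:
  fixes x :: real
  assumes "0 \<le> x"
  shows "x - x ^ 3 / 6 \<le> sin x"
proof -
  have "(\<lambda>x. sin x - (x - x ^ 3 / 6)) 0 \<le> (\<lambda>x. sin x - (x - x ^ 3 / 6)) x"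
  proof (rule DERIV_nonneg_imp_nondecreasing[OF assms])
    fix y :: real
    have "((\<lambda>x. sin x - (x - x ^ 3 / 6)) has_real_derivative cos y - (1 - y\<^sup>2 / 2)) (at y)"
      by (auto intro!: derivative_eq_intros)
    then show "\<exists>D. ((\<lambda>x. sin x - (x - x ^ 3 / 6)) has_real_derivative D) (at y) \<and> 0 \<le> D"
      using cos_ge_quadratic[of y] by (metis diff_ge_0_iff_ge)
  qed
  then show ?thesis by simp
qed

lemma sin_minus_x_cos_le:
  fixes x :: real
  assumes "0 \<le> x"
  shows "sin x - x * cos x \<le> x ^ 3 / 3"
proof -
  have "(\<lambda>x. x ^ 3 / 3 - (sin x - x * cos x)) 0 \<le> (\<lambda>x. x ^ 3 / 3 - (sin x - x * cos x)) x"
  proof (rule DERIV_nonneg_imp_nondecreasing[OF assms])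
    fix y :: real assume y: "0 \<le> y" "y \<le> x"
    have "((\<lambda>x. x ^ 3 / 3 - (sin x - x * cos x)) has_real_derivative y * (y - sin y)) (at y)"
      by (auto intro!: derivative_eq_intros simp: algebra_simps power2_eq_square)
    moreover have "y * (y - sin y) \<ge> 0" using y sin_x_le_x[of y] by simp
    ultimately show "\<exists>D. ((\<lambda>x. x ^ 3 / 3 - (sin x - x * cos x)) has_real_derivative D) (at y) \<and> 0 \<le> D"
      by blast
  qed
  then show ?thesis by simp
qed

text \<open>
  With \<open>x = y \<theta>\<close> the numerator of the derivative is \<open>(x cos x - sin x) (1 - y\<^sup>2) + 2 y\<^sup>2 sin x\<close>. The cubic
  bounds for the two trigonometric terms give the lower bound \<open>x y\<^sup>2 (2 - \<theta>\<^sup>2 / 3)\<close>, hence the condition on \<open>\<theta>\<close>.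
\<close>
lemma sin_over_cubic_weight_mono:
  fixes \<theta> :: real
  assumes th: "0 < \<theta>" "\<theta>\<^sup>2 \<le> 6" and uv: "0 < u" "u \<le> v" "v < 1"
  shows "sin (u * \<theta>) / (u - u ^ 3) \<le> sin (v * \<theta>) / (v - v ^ 3)"
proof (rule DERIV_nonneg_imp_nondecreasing[OF uv(2)])
  fix y assume y': "u \<le> y" "y \<le> v"
  with uv have y: "0 < y" "y < 1" by auto
  have w: "y - y ^ 3 > 0" using y by (simp add: power_strict_decreasing[of 1 3 y, simplified])
  define x where "x = y * \<theta>"
  have x: "x > 0" using y th by (simp add: x_def)
  have "x * y\<^sup>2 * (2 - \<theta>\<^sup>2 / 3) = - (x ^ 3 / 3) * (1 - y\<^sup>2) + 2 * y\<^sup>2 * (x - x ^ 3 / 6)"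
    by (simp add: x_def field_simps power2_eq_square power3_eq_cube)
  also have "\<dots> \<le> - (sin x - x * cos x) * (1 - y\<^sup>2) + 2 * y\<^sup>2 * sin x"
    using sin_minus_x_cos_le[of x] sin_ge_cubic[of x] x y
    by (intro add_mono mult_right_mono mult_left_mono) (auto simp: abs_square_le_1)
  also have "\<dots> = \<theta> * cos x * (y - y ^ 3) - sin x * (1 - 3 * y\<^sup>2)"
    by (simp add: x_def algebra_simps power2_eq_square power3_eq_cube)
  finally have num: "0 \<le> \<theta> * cos x * (y - y ^ 3) - sin x * (1 - 3 * y\<^sup>2)"
    by (rule order_trans[rotated]) (use x th in simp)
  have "((\<lambda>u. sin (u * \<theta>) / (u - u ^ 3)) has_real_derivative
      (\<theta> * cos x * (y - y ^ 3) - sin x * (1 - 3 * y\<^sup>2)) / (y - y ^ 3)\<^sup>2) (at y)"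
    using w by (auto intro!: derivative_eq_intros simp: x_def power2_eq_square)
  then show "\<exists>D. ((\<lambda>u. sin (u * \<theta>) / (u - u ^ 3)) has_real_derivative D) (at y) \<and> 0 \<le> D"
    using num by (meson divide_nonneg_nonneg zero_le_power2)
qed

lemma cum_interp_weight_integral:
  "((\<lambda>u. cum_interp \<mu> u * (u - u ^ 3)) has_integral 203/960 + 53/1920 * \<mu>) {0..1}"
proof -
  have 1: "((\<lambda>u. cum_interp \<mu> u * (u - u ^ 3)) has_integral
    (2 * ((1/2) ^ 3 / 3 - (1/2) ^ 5 / 5)) - (2 * (0 ^ 3 / 3 - 0 ^ 5 / 5))) {0..1/2::real}"
    by (rule has_integral_eq[where f = "\<lambda>u. 2 * u * (u - u ^ 3)"],
      simp add: cum_interp_start, rule fundamental_theorem_of_calculus)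
      (auto intro!: derivative_eq_intros simp: algebra_simps power_numeral_reduce
        simp flip: has_real_derivative_iff_has_vector_derivative)
  define F where "F u = u ^ 2 / 2 - u ^ 4 / 4 + \<mu> * (u ^ 3 / 3 - u ^ 5 / 5 - u ^ 2 / 4 + u ^ 4 / 8)"
    for u :: real
  have 2: "((\<lambda>u. cum_interp \<mu> u * (u - u ^ 3)) has_integral F 1 - F (1/2)) {1/2..1::real}"
  proof (rule has_integral_eq[where f = "\<lambda>u. (1 + \<mu> * (u - 1/2)) * (u - u ^ 3)"])
    show "(1 + \<mu> * (u - 1/2)) * (u - u ^ 3) = cum_interp \<mu> u * (u - u ^ 3)"
      if "u \<in> {1/2..1}" for u
      using cum_interp_piece[of 0 u \<mu>] that by (simp add: bcoeff_Suc)
    show "((\<lambda>u. (1 + \<mu> * (u - 1/2)) * (u - u ^ 3)) has_integral F 1 - F (1/2)) {1/2..1}"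
      unfolding F_def
      by (rule fundamental_theorem_of_calculus)
        (auto intro!: derivative_eq_intros simp: field_simps power_numeral_reduce
          simp flip: has_real_derivative_iff_has_vector_derivative)
  qed
  show ?thesis
    by (rule has_integral_eq_rhs[OF has_integral_combine[OF _ _ 1 2]])
      (simp_all add: F_def field_simps power_numeral_reduce)
qed

lemma powr_weight_integral:
  fixes \<mu> :: real
  assumes "\<mu> > 0"
  shows "((\<lambda>u. u powr \<mu> * (u - u ^ 3)) has_integral 2 / ((\<mu> + 2) * (\<mu> + 4))) {0..1}"
proof -
  have "((\<lambda>u. u powr (\<mu> + 1) - u powr (\<mu> + 3)) has_integral
      1 powr (\<mu> + 1 + 1) / (\<mu> + 1 + 1) - 1 powr (\<mu> + 3 + 1) / (\<mu> + 3 + 1)) {0..1}"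
    using assms by (intro has_integral_diff has_integral_powr_from_0) auto
  moreover have "u powr (\<mu> + 1) - u powr (\<mu> + 3) = u powr \<mu> * (u - u ^ 3)" if "u \<in> {0..1}" for u :: real
    using that powr_realpow[of u 3] by (cases "u = 0") (simp_all add: powr_add algebra_simps)
  ultimately have "((\<lambda>u. u powr \<mu> * (u - u ^ 3)) has_integral
      1 powr (\<mu> + 1 + 1) / (\<mu> + 1 + 1) - 1 powr (\<mu> + 3 + 1) / (\<mu> + 3 + 1)) {0..1}"
    by (rule has_integral_eq[rotated])
  moreover have "1 powr (\<mu> + 1 + 1) / (\<mu> + 1 + 1) - 1 powr (\<mu> + 3 + 1) / (\<mu> + 3 + 1)
      = 2 / ((\<mu> + 2) * (\<mu> + 4))"
    using assms by (simp add: divide_simps) (simp add: algebra_simps)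
  ultimately show ?thesis by simp
qed

text \<open>
  The difference changes sign only once on \<open>[0, 1]\<close>: up to \<open>1/2\<close> it is \<open>u\<^sup>\<mu>\<close> times the increasing
  function \<open>2 u\<^sup>1\<^sup>-\<^sup>\<mu> - \<kappa>\<close>, and from there on the monotone quotient keeps it nonnegative.
\<close>
lemma cum_interp_minus_powr_sign:
  assumes mu: "1/2 \<le> \<mu>" "\<mu> < 1" and kap: "0 < \<kappa>" "\<kappa> \<le> cum_interp \<mu> 1"
  obtains u0 where "0 < u0" "u0 \<le> 1/2"
    "\<And>u. 0 \<le> u \<Longrightarrow> u \<le> u0 \<Longrightarrow> cum_interp \<mu> u \<le> \<kappa> * u powr \<mu>"
    "\<And>u. u0 \<le> u \<Longrightarrow> u \<le> 1 \<Longrightarrow> cum_interp \<mu> u \<ge> \<kappa> * u powr \<mu>"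
proof -
  have right: "cum_interp \<mu> u \<ge> \<kappa> * u powr \<mu>" if "1/2 \<le> u" "u \<le> 1" for u
  proof -
    have "\<kappa> \<le> cum_interp \<mu> u / u powr \<mu>"
      using cum_interp_ratio_decreasing[of \<mu> u 1] mu kap that by simp
    then show ?thesis using that by (simp add: field_simps)
  qed
  \<comment> \<open>the zero of \<open>2 u\<^sup>1\<^sup>-\<^sup>\<mu> - \<kappa>\<close>\<close>
  define u0 where "u0 = (\<kappa> / 2) powr (1 / (1 - \<mu>))"
  have pow: "u0 powr (1 - \<mu>) = \<kappa> / 2" using mu kap by (simp add: u0_def powr_powr)
  have split: "u = u powr \<mu> * u powr (1 - \<mu>)" if "u > 0" for u :: real
    using that by (simp flip: powr_add)
  have u0: "u0 > 0" using kap by (simp add: u0_def)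
  have left: "cum_interp \<mu> u \<le> \<kappa> * u powr \<mu>" if "0 \<le> u" "u \<le> u0" "u \<le> 1/2" for u
  proof (cases "u = 0")
    case False
    then have "u powr (1 - \<mu>) \<le> \<kappa> / 2"
      using that mu by (simp flip: pow add: powr_mono2)
    then have "2 * (u powr \<mu> * u powr (1 - \<mu>)) \<le> 2 * (u powr \<mu> * (\<kappa> / 2))"
      by (intro mult_left_mono) auto
    then show ?thesis using split[of u] that False by (simp add: cum_interp_start mult_ac)
  qed (simp add: cum_interp_start)
  have mid: "cum_interp \<mu> u \<ge> \<kappa> * u powr \<mu>" if "u0 \<le> u" "u \<le> 1/2" for u
  proof -
    have "\<kappa> / 2 \<le> u powr (1 - \<mu>)"
      using that mu u0 by (simp flip: pow add: powr_mono2)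
    then have "2 * (u powr \<mu> * (\<kappa> / 2)) \<le> 2 * (u powr \<mu> * u powr (1 - \<mu>))"
      by (intro mult_left_mono) auto
    then show ?thesis using split[of u] that u0 by (simp add: cum_interp_start mult_ac)
  qed
  have "u0 \<le> 1/2"
  proof (rule ccontr)
    assume "\<not> u0 \<le> 1/2"
    then have "(1/2) powr (1 - \<mu>) < u0 powr (1 - \<mu>)"
      using mu by (intro powr_less_mono2) auto
    then have "(1/2) powr \<mu> * (2 * (1/2) powr (1 - \<mu>)) < (1/2) powr \<mu> * \<kappa>"
      unfolding pow by (intro mult_strict_left_mono) auto
    moreover have "1 \<ge> \<kappa> * (1/2) powr \<mu>" using right[of "1/2"] by (simp add: cum_interp_start)
    moreover have "(1/2) powr \<mu> * (2 * (1/2) powr (1 - \<mu>)) = 1"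
      using split[of "1/2"] by simp
    ultimately show False by (simp add: mult.commute)
  qed
  show thesis
  proof (rule that[OF u0 \<open>u0 \<le> 1/2\<close>])
    fix u
    show "cum_interp \<mu> u \<le> \<kappa> * u powr \<mu>" if "0 \<le> u" "u \<le> u0"
      using left that \<open>u0 \<le> 1/2\<close> by simp
    show "cum_interp \<mu> u \<ge> \<kappa> * u powr \<mu>" if "u0 \<le> u" "u \<le> 1"
      using mid right that by (cases "u \<le> 1/2") auto
  qed
qed

text \<open>
  Since \<open>L(1) = (\<mu> + 2) / 2\<close>, the subtracted part is at most \<open>1 / (\<mu> + 4)\<close>, and the claim becomes a
  quadratic inequality in \<open>\<mu>\<close>, true from a little below \<open>1/2\<close> on.
\<close>
lemma weighted_difference_integral_nonneg:
  assumes mu: "1/2 \<le> \<mu>" and kap: "\<kappa> \<le> cum_interp \<mu> 1"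
    and J: "((\<lambda>u. (cum_interp \<mu> u - \<kappa> * u powr \<mu>) * (u - u ^ 3)) has_integral J) {0..1}"
  shows "J \<ge> 0"
proof -
  have "((\<lambda>u. cum_interp \<mu> u * (u - u ^ 3) - \<kappa> * (u powr \<mu> * (u - u ^ 3))) has_integral
      (203/960 + 53/1920 * \<mu>) - \<kappa> * (2 / ((\<mu> + 2) * (\<mu> + 4)))) {0..1}"
    using mu by (intro has_integral_diff has_integral_mult_right
      cum_interp_weight_integral powr_weight_integral) auto
  then have "J = (203/960 + 53/1920 * \<mu>) - \<kappa> * (2 / ((\<mu> + 2) * (\<mu> + 4)))"
    using J by (simp add: left_diff_distrib mult.assoc has_integral_unique)
  moreover have "\<kappa> * (2 / ((\<mu> + 2) * (\<mu> + 4))) \<le> (\<mu> + 2) / 2 * (2 / ((\<mu> + 2) * (\<mu> + 4)))"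
    using kap mu cum_interp_piece[of 0 1 \<mu>] by (intro mult_right_mono) (auto simp: bcoeff_Suc)
  moreover have "(\<mu> + 2) / 2 * (2 / ((\<mu> + 2) * (\<mu> + 4))) = 1 / (\<mu> + 4)"
    using mu by (simp add: divide_simps)
  moreover have "1 / (\<mu> + 4) \<le> 203/960 + 53/1920 * \<mu>"
  proof -
    have "\<mu> * \<mu> \<ge> 1/2 * (1/2)" using mu by (intro mult_mono) auto
    then have "(406 + 53 * \<mu>) * (\<mu> + 4) \<ge> 1920" using mu by (simp add: algebra_simps)
    then show ?thesis using mu by (simp add: field_simps)
  qed
  ultimately show ?thesis by linarith
qed

text \<open>
  On \<open>[1, 3\<pi>/(2\<theta>)]\<close> the difference \<open>L - \<kappa> u\<^sup>\<mu>\<close> and the sine both change sign at \<open>\<pi> / \<theta>\<close>. On \<open>[0, 1]\<close> the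
  difference changes from negative to positive at \<open>u0\<close>. As \<open>sin (u \<theta>)\<close> divided by \<open>u - u\<^sup>3\<close>
  increases, freezing this quotient at its value in \<open>u0\<close> can only make the integral smaller, and
  the frozen integral is nonnegative by the preceding lemma.
\<close>
lemma cum_interp_sin_integral_nonneg:
  assumes mu: "1/2 \<le> \<mu>" "\<mu> < 1" and th: "0 < \<theta>" "\<theta> \<le> 2 * pi / 3"
    and zero: "((\<lambda>u. u powr \<mu> * sin (u * \<theta>)) has_integral 0) {0..3 * pi / (2 * \<theta>)}"
    and I: "((\<lambda>u. cum_interp \<mu> u * sin (u * \<theta>)) has_integral I) {0..3 * pi / (2 * \<theta>)}"
  shows "I \<ge> 0"
proof -
  define c y where "c = pi / \<theta>" and "y = 3 * pi / (2 * \<theta>)"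
  have cy: "1 \<le> c" "c \<le> y" using th pi_gt_zero by (simp_all add: c_def y_def field_simps)
  have "pi < 3.1416" using pi_approx by simp
  then have "\<theta> \<le> 2.1" using th by simp
  then have "\<theta>\<^sup>2 \<le> 2.1\<^sup>2" using th by (intro power_mono) auto
  then have th2: "\<theta>\<^sup>2 \<le> 6" by (simp add: power2_eq_square)
  define \<kappa> where "\<kappa> = cum_interp \<mu> c / c powr \<mu>"
  have kap_le: "\<kappa> \<le> cum_interp \<mu> 1"
    using cum_interp_ratio_decreasing[of \<mu> 1 c] mu cy by (simp add: \<kappa>_def)
  have kap_pos: "\<kappa> > 0"
  proof -
    obtain k where k: "real k + 1/2 \<le> c" "c \<le> real k + 3/2"
      using half_integer_piece[of c] cy by auto
    have "cum_interp \<mu> c > 0"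
      unfolding cum_interp_piece[OF k]
      using bcoeff_pos[of "\<mu> + 1" k] bcoeff_pos[of \<mu> "Suc k"] mu k by (intro add_pos_nonneg) auto
    then show ?thesis using cy by (simp add: \<kappa>_def)
  qed
  define q where "q u = cum_interp \<mu> u - \<kappa> * u powr \<mu>" for u
  have qI: "((\<lambda>u. q u * sin (u * \<theta>)) has_integral I) {0..y}"
    using has_integral_diff[OF I has_integral_mult_right[OF zero, of \<kappa>]]
    by (simp add: q_def y_def algebra_simps)
  then have int: "(\<lambda>u. q u * sin (u * \<theta>)) integrable_on {0..y}" by blast
  have int1: "(\<lambda>u. q u * sin (u * \<theta>)) integrable_on {0..1}"
    and int2: "(\<lambda>u. q u * sin (u * \<theta>)) integrable_on {1..y}"
    using cy by (auto intro: integrable_subinterval_real[OF int])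
  have "I = integral {0..1} (\<lambda>u. q u * sin (u * \<theta>)) + integral {1..y} (\<lambda>u. q u * sin (u * \<theta>))"
    using Henstock_Kurzweil_Integration.integral_combine[OF _ _ int, of 1] cy qI
    by (simp add: integral_unique)
  moreover have "integral {1..y} (\<lambda>u. q u * sin (u * \<theta>)) \<ge> 0"
  proof (rule integral_nonneg[OF int2])
    fix u assume u: "u \<in> {1..y}"
    show "0 \<le> q u * sin (u * \<theta>)"
    proof (cases "u \<le> c")
      case True
      then have "\<kappa> \<le> cum_interp \<mu> u / u powr \<mu>"
        using cum_interp_ratio_decreasing[of \<mu> u c] mu u by (simp add: \<kappa>_def)
      then have "q u \<ge> 0" using u by (simp add: q_def field_simps)
      moreover have "sin (u * \<theta>) \<ge> 0"
        using True u th by (intro sin_ge_zero) (auto simp: c_def field_simps)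
      ultimately show ?thesis by simp
    next
      case False
      then have "cum_interp \<mu> u / u powr \<mu> \<le> \<kappa>"
        using cum_interp_ratio_decreasing[of \<mu> c u] mu cy by (simp add: \<kappa>_def)
      then have q: "q u \<le> 0" using u by (simp add: q_def field_simps)
      have "pi \<le> u * \<theta>" using False th by (simp add: c_def field_simps)
      have "u * \<theta> \<le> 3 * pi / 2" using u th by (simp add: y_def field_simps)
      then have "sin (u * \<theta>) \<le> 0"
        using pi_gt_zero \<open>pi \<le> u * \<theta>\<close> by (intro sin_le_zero) linarith+
      with q show ?thesis by (simp add: mult_nonpos_nonpos)
    qed
  qed
  moreover have "integral {0..1} (\<lambda>u. q u * sin (u * \<theta>)) \<ge> 0"
  proof -
    obtain u0 where u0: "0 < u0" "u0 \<le> 1/2"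
      and q_neg: "\<And>u. 0 \<le> u \<Longrightarrow> u \<le> u0 \<Longrightarrow> q u \<le> 0"
      and q_pos: "\<And>u. u0 \<le> u \<Longrightarrow> u \<le> 1 \<Longrightarrow> q u \<ge> 0"
      unfolding q_def using cum_interp_minus_powr_sign[OF mu kap_pos kap_le]
      by (metis diff_ge_0_iff_ge diff_le_0_iff_le)
    define \<rho> where "\<rho> = sin (u0 * \<theta>) / (u0 - u0 ^ 3)"
    have wpos: "u - u ^ 3 > 0" if "0 < u" "u < 1" for u :: real
      using that power_strict_decreasing[of 1 3 u] by simp
    have "u0 * \<theta> \<le> 1/2 * (2 * pi / 3)" using u0 th by (intro mult_mono) auto
    then have "sin (u0 * \<theta>) \<ge> 0" using u0 th by (intro sin_ge_zero) auto
    then have rho: "\<rho> \<ge> 0" using wpos[of u0] u0 by (simp add: \<rho>_def)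
    have "(\<lambda>u. q u * (u - u ^ 3)) integrable_on {0..1}"
      unfolding q_def left_diff_distrib mult.assoc
      using cum_interp_weight_integral powr_weight_integral[of \<mu>] mu
      by (intro integrable_diff integrable_on_mult_right) (auto intro: has_integral_integrable)
    then obtain J where J: "((\<lambda>u. q u * (u - u ^ 3)) has_integral J) {0..1}" by blast
    have "J \<ge> 0"
      using weighted_difference_integral_nonneg[OF _ kap_le] J mu by (simp add: q_def)
    have "\<rho> * J \<le> integral {0..1} (\<lambda>u. q u * sin (u * \<theta>))"
    proof (rule has_integral_le[OF has_integral_mult_right[OF J] integrable_integral[OF int1]])
      fix u :: real assume u: "u \<in> {0..1}"
      consider "u = 0" | "u = 1" | "0 < u" "u \<le> u0" "u < 1" | "u0 \<le> u" "u < 1" using u by force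
      then show "\<rho> * (q u * (u - u ^ 3)) \<le> q u * sin (u * \<theta>)"
      proof cases
        case 2
        have "sin \<theta> \<ge> 0" using th by (intro sin_ge_zero) auto
        then show ?thesis using 2 q_pos[of u] u0 by simp
      next
        case 3
        have "sin (u * \<theta>) / (u - u ^ 3) \<le> \<rho>"
          unfolding \<rho>_def using 3 u0 th th2 by (intro sin_over_cubic_weight_mono) auto
        then have "sin (u * \<theta>) \<le> \<rho> * (u - u ^ 3)" using wpos[of u] 3 by (simp add: field_simps)
        from mult_left_mono_neg[OF this, of "q u"] q_neg[of u] 3
        show ?thesis by (simp add: mult_ac)
      next
        case 4
        have "\<rho> \<le> sin (u * \<theta>) / (u - u ^ 3)"
          unfolding \<rho>_def using 4 u0 th th2 by (intro sin_over_cubic_weight_mono) auto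
        then have "\<rho> * (u - u ^ 3) \<le> sin (u * \<theta>)" using wpos[of u] 4 u0 by (simp add: field_simps)
        from mult_left_mono[OF this, of "q u"] q_pos[of u] 4
        show ?thesis by (simp add: mult_ac)
      qed simp
    qed
    then show ?thesis using \<open>J \<ge> 0\<close> rho by (meson mult_nonneg_nonneg order_trans)
  qed
  ultimately show ?thesis by simp
qed

section \<open>Nonnegative cosine sums\<close>

text \<open>
  Let \<open>m\<close> be the index whose linear piece contains \<open>y = 3 \<pi> / (2 \<theta>)\<close>. The integral up to \<open>y\<close>, times
  \<open>\<theta>\<^sup>2\<close>, is the number \<open>E\<close> below. By the tail estimate, \<open>E\<close> is a lower bound for every sum from \<open>m\<close>
  on, multiplied by \<open>2 sin (\<theta>/2)\<close>. Between \<open>\<pi>/2\<close>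
  and \<open>3\<pi>/2\<close> the added cosines are nonpositive, so a sum with smaller index is at least the one at
  \<open>m\<close>, unless all its terms are nonnegative anyway.
\<close>
lemma cos_sum_nonneg_away_from_pi:
  assumes th: "0 < \<theta>" "\<theta> \<le> 2 * pi / 3"
  shows "cos_sum (1 - alpha0) n \<theta> \<ge> 0"
proof -
  define \<mu> where "\<mu> = 1 - alpha0"
  have mu: "1/2 \<le> \<mu>" "\<mu> < 1" using alpha0_bounds by (simp_all add: \<mu>_def)
  define y where "y = 3 * pi / (2 * \<theta>)"
  have y: "y * \<theta> = 3 * pi / 2" using th by (simp add: y_def)
  have sin_half: "sin (\<theta> / 2) > 0" using th by (intro sin_gt_zero) auto
  have "1/2 \<le> y" using th pi_gt_zero by (simp add: y_def field_simps)
  then obtain m where m: "real m + 1/2 \<le> y" "y \<le> real m + 3/2"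
    using half_integer_piece by blast
  have bpos: "bcoeff \<mu> k > 0" for k using mu by (intro bcoeff_pos) simp
  define E where "E = 2 * sin (\<theta> / 2) * cos_sum \<mu> m \<theta>
    - bcoeff \<mu> (Suc m) * (1 + sin ((real m + 1/2) * \<theta>))"
  have int: "((\<lambda>u. \<theta>\<^sup>2 * (cum_interp \<mu> u * sin (u * \<theta>))) has_integral E) {0..y}"
    using cum_interp_sin_integral[OF m, of \<theta> \<mu>]
    unfolding y sin_three_halves_pi cos_three_halves_pi by (simp add: E_def algebra_simps)
  have "((\<lambda>u. inverse (\<theta>\<^sup>2) * (\<theta>\<^sup>2 * (cum_interp \<mu> u * sin (u * \<theta>)))) has_integral
      inverse (\<theta>\<^sup>2) * E) {0..y}"
    by (rule has_integral_mult_right[OF int])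
  then have "((\<lambda>u. cum_interp \<mu> u * sin (u * \<theta>)) has_integral inverse (\<theta>\<^sup>2) * E) {0..y}"
    using th by (simp flip: mult.assoc)
  then have "inverse (\<theta>\<^sup>2) * E \<ge> 0"
    using cum_interp_sin_integral_nonneg[OF mu th, of "inverse (\<theta>\<^sup>2) * E"]
      powr_sin_integral_zero[of \<theta>] th by (simp add: y_def \<mu>_def)
  then have E: "E \<ge> 0" using th by (simp add: zero_le_mult_iff)
  have "cos_sum \<mu> n \<theta> \<ge> 0"
  proof (cases "m \<le> n")
    case True
    then have "2 * sin (\<theta> / 2) * cos_sum \<mu> n \<theta> \<ge> E"
      using cos_sum_tail_lower_bound[of \<mu> m n \<theta>] mu by (simp add: E_def)
    with E have "2 * sin (\<theta> / 2) * cos_sum \<mu> n \<theta> \<ge> 0" by linarith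
    then show ?thesis using sin_half by (simp add: zero_le_mult_iff)
  next
    case False
    have le: "real k * \<theta> \<le> 3 * pi / 2" if "k \<le> m" for k
    proof -
      have "real k * \<theta> \<le> y * \<theta>" using that m th by (intro mult_right_mono) auto
      then show ?thesis by (simp add: y)
    qed
    show ?thesis
    proof (cases "real n * \<theta> \<le> pi / 2")
      case True
      have "cos (real k * \<theta>) \<ge> 0" if "k \<le> n" for k
      proof -
        have "real k * \<theta> \<le> real n * \<theta>" using that th by (intro mult_right_mono) auto
        moreover have "0 \<le> real k * \<theta>" using th by simp
        ultimately show ?thesis using True pi_gt_zero by (intro cos_ge_zero) linarith+
      qed
      then show ?thesis unfolding cos_sum_def
        using bpos by (intro sum_nonneg mult_nonneg_nonneg) (auto intro: less_imp_le)
    next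
      case False': False
      have "cos (real k * \<theta>) \<le> 0" if "k \<in> {Suc n..m}" for k
      proof -
        have "real n * \<theta> \<le> real k * \<theta>" using that th by (intro mult_right_mono) auto
        then have "cos (real k * \<theta> - pi) \<ge> 0"
          using False' le[of k] that by (intro cos_ge_zero) auto
        then show ?thesis by simp
      qed
      then have "(\<Sum>k=Suc n..m. bcoeff \<mu> k * cos (real k * \<theta>)) \<le> 0"
        using bpos by (intro sum_nonpos mult_nonneg_nonpos) (auto intro: less_imp_le)
      then have "cos_sum \<mu> m \<theta> \<le> cos_sum \<mu> n \<theta>"
        using cos_sum_tail[of n m \<mu> \<theta>] False by simp
      moreover have "0 \<le> bcoeff \<mu> (Suc m) * (1 + sin ((real m + 1/2) * \<theta>))"
        using bpos[of "Suc m"] sin_ge_minus_one[of "(real m + 1/2) * \<theta>"]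
        by (intro mult_nonneg_nonneg) linarith+
      then have "2 * sin (\<theta> / 2) * cos_sum \<mu> m \<theta> \<ge> 0" using E unfolding E_def by linarith
      then have "cos_sum \<mu> m \<theta> \<ge> 0" using sin_half by (simp add: zero_le_mult_iff)
      ultimately show ?thesis by linarith
    qed
  qed
  then show ?thesis by (simp add: \<mu>_def)
qed

lemma cos_sum_nonneg:
  assumes "\<bar>\<theta>\<bar> \<le> pi"
  shows "cos_sum (1 - alpha0) n \<theta> \<ge> 0"
proof -
  have even: "cos_sum (1 - alpha0) n \<theta> = cos_sum (1 - alpha0) n \<bar>\<theta>\<bar>"
    by (simp add: cos_sum_def abs_if)
  have mu: "0 < 1 - alpha0" "1 - alpha0 \<le> 23/25" using alpha0_bounds by simp_all
  consider "\<theta> = 0" | "0 < \<bar>\<theta>\<bar>" "\<bar>\<theta>\<bar> \<le> 2 * pi / 3" | "2 * pi / 3 \<le> \<bar>\<theta>\<bar>" by force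
  then show ?thesis
  proof cases
    case 1
    then have "cos_sum (1 - alpha0) n \<theta> = (\<Sum>k=0..n. bcoeff (1 - alpha0) k)"
      by (simp add: cos_sum_def)
    also have "\<dots> \<ge> 0" using bcoeff_pos[OF mu(1)] by (intro sum_nonneg less_imp_le)
    finally show ?thesis .
  next
    case 2
    then show ?thesis unfolding even by (rule cos_sum_nonneg_away_from_pi)
  next
    case 3
    then show ?thesis unfolding even using mu assms by (intro cos_sum_nonneg_near_pi) auto
  qed
qed

text \<open>
  The hypothesis says that \<open>a k / bcoeff (1 - alpha0) k\<close> decreases, so Abel's inequality carries the
  bound over from the extremal coefficients.
\<close>
lemma cos_sum_nonneg_general_coeffs:
  fixes a :: "nat \<Rightarrow> real"
  assumes pos: "\<And>k. k \<le> n \<Longrightarrow> a k > 0"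
    and ratio: "\<And>k. 1 \<le> k \<Longrightarrow> k \<le> n \<Longrightarrow> real k * a k \<le> (real k - alpha0) * a (k - 1)"
    and th: "\<bar>\<theta>\<bar> \<le> pi"
  shows "(\<Sum>k=0..n. a k * cos (real k * \<theta>)) \<ge> 0"
proof -
  define d where "d = bcoeff (1 - alpha0)"
  have d: "d k > 0" for k using alpha0_bounds unfolding d_def by (intro bcoeff_pos) simp
  have "(\<Sum>k=0..n. a k / d k * (d k * cos (real k * \<theta>))) \<ge> - 0 * (a 0 / d 0)"
  proof (rule abel_sum_lower_bound)
    show "(\<Sum>k=0..j. d k * cos (real k * \<theta>)) \<ge> - 0" for j
      using cos_sum_nonneg[OF th, of j] by (simp add: cos_sum_def d_def)
    show "a (Suc k) / d (Suc k) \<le> a k / d k" if "k < n" for k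
    proof -
      have "d (Suc k) * (real k + 1) = d k * (real k + 1 - alpha0)"
        by (simp add: d_def bcoeff_Suc add.commute diff_add_eq)
      moreover have "(real k + 1) * a (Suc k) \<le> (real k + 1 - alpha0) * a k"
        using ratio[of "Suc k"] that by (simp add: add.commute)
      from mult_left_mono[OF this, of "d k"] d[of k]
      have "(real k + 1) * (a (Suc k) * d k) \<le> (d k * (real k + 1 - alpha0)) * a k"
        by (simp add: mult_ac)
      ultimately have "(real k + 1) * (a (Suc k) * d k) \<le> (real k + 1) * (a k * d (Suc k))"
        by (metis mult.commute mult.left_commute)
      then have "a (Suc k) * d k \<le> a k * d (Suc k)" by simp
      then show ?thesis using d[of k] d[of "Suc k"] by (simp add: field_simps)
    qed
    show "a n / d n \<ge> 0" using pos[of n] d[of n] by simp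
  qed simp
  moreover have "a k / d k * (d k * cos (real k * \<theta>)) = a k * cos (real k * \<theta>)" for k
    using d[of k] by simp
  ultimately show ?thesis by simp
qed

text \<open>
  The maximum principle gives the weak inequality. If the real part vanished at an interior
  point, the modulus of \<open>exp (-p)\<close> would be maximal there and hence constant, against its value
  \<open>exp (- a 0) < 1\<close> at the origin.
\<close>
lemma Re_polynomial_pos_in_disc:
  fixes a :: "nat \<Rightarrow> real" and z :: complex
  assumes bdry: "\<And>\<theta>. \<bar>\<theta>\<bar> \<le> pi \<Longrightarrow> (\<Sum>k=0..n. a k * cos (real k * \<theta>)) \<ge> 0"
    and a0: "a 0 > 0" and z: "norm z < 1"
  shows "Re (\<Sum>k=0..n. of_real (a k) * z ^ k) > 0"
proof -
  define p where "p w = (\<Sum>k=0..n. of_real (a k) * w ^ k)" for w :: complex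
  have hol: "p holomorphic_on S" for S unfolding p_def by (intro holomorphic_intros)
  have nonneg: "Re (p w) \<ge> 0" if w: "norm w < 1" for w
  proof -
    have "Re (- p w) \<le> 0"
    proof (rule maximum_real_frontier[of "\<lambda>w. - p w" "ball 0 1"])
      show "continuous_on (closure (ball 0 1)) (\<lambda>w. - p w)"
        unfolding p_def by (intro continuous_intros)
      fix v :: complex assume "v \<in> frontier (ball 0 1)"
      then have "norm v = 1" by simp
      then have v: "v = cis (Arg v)" by (metis cis_Arg norm_zero scaleR_one sgn_div_norm inverse_1 zero_neq_one)
      have "v ^ k = cis (real k * Arg v)" for k using Complex.DeMoivre[of "Arg v" k] v by simp
      then have "Re (p v) = (\<Sum>k=0..n. a k * cos (real k * Arg v))" by (simp add: p_def)
      moreover have "\<bar>Arg v\<bar> \<le> pi" using Arg_bounded[of v] by (simp add: abs_le_iff)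
      ultimately show "Re (- p v) \<le> 0" using bdry by simp
    qed (use hol w in \<open>auto intro!: holomorphic_intros\<close>)
    then show ?thesis by simp
  qed
  have "Re (p z) \<noteq> 0"
  proof
    assume zero: "Re (p z) = 0"
    have "(\<lambda>w. exp (- p w)) constant_on ball 0 1"
    proof (rule maximum_modulus_principle[where U = "ball 0 1" and \<xi> = z])
      show "(\<lambda>w. exp (- p w)) holomorphic_on ball 0 1" by (intro holomorphic_intros hol)
      show "norm (exp (- p w)) \<le> norm (exp (- p z))" if "w \<in> ball 0 1" for w
        using nonneg[of w] that zero by simp
    qed (use z in auto)
    then obtain C where "\<And>w. w \<in> ball 0 1 \<Longrightarrow> exp (- p w) = C" by (auto simp: constant_on_def)
    then have "norm (exp (- p z)) = norm (exp (- p 0))" using z by simp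
    moreover have "p 0 = of_real (a 0)"
      by (simp add: p_def power_0_left if_distrib sum.delta cong: if_cong)
    ultimately show False using zero a0 by simp
  qed
  then show ?thesis using nonneg[OF z] by (simp add: p_def)
qed

section \<open>The Laplace integral for Gegenbauer polynomials\<close>

lemma gegenbauer_0: "gegenbauer l 0 x = 1"
  by (simp add: gegenbauer_def)

text \<open>
  With \<open>P = - 2 x X + X\<^sup>2\<close>, the differential equation \<open>(1 + P) G' = - l P' G\<close> of the generating function.
\<close>
lemma gegenbauer_fps_ODE:
  fixes l x :: real
  defines "P \<equiv> fps_const (-2 * x) * fps_X + fps_X ^ 2"
  defines "G \<equiv> fps_binomial (-l) oo P"
  shows "fps_deriv G + fps_const (-2 * x) * (fps_X * fps_deriv G) + fps_X * (fps_X * fps_deriv G)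
    = fps_const (-l) * (fps_const (-2 * x) * G + fps_const 2 * (fps_X * G))"
proof -
  have P0: "fps_nth P 0 = 0" by (simp add: P_def)
  have unit: "fps_nth (1 + fps_X :: real fps) 0 \<noteq> 0" by simp
  have "fps_deriv (fps_binomial (-l)) * (1 + fps_X) = fps_const (-l) * fps_binomial (-l)"
    by (simp add: fps_binomial_deriv fps_divide_unit[OF unit] mult.assoc inverse_mult_eq_1[OF unit])
  then have "(fps_deriv (fps_binomial (-l)) * (1 + fps_X)) oo P = (fps_const (-l) * fps_binomial (-l)) oo P"
    by (simp only:)
  then have "(fps_deriv (fps_binomial (-l)) oo P) * (1 + P) = fps_const (-l) * G"
    using P0 by (simp only: fps_compose_mult_distrib[OF P0] fps_compose_add_distrib fps_compose_1
      fps_const_compose fps_X_fps_compose_startby0 G_def)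
  then have "fps_deriv G * (1 + P) = fps_const (-l) * G * fps_deriv P"
    by (simp add: G_def fps_compose_deriv[OF P0] mult_ac)
  moreover have "fps_deriv P = fps_const (-2 * x) + fps_const 2 * fps_X"
    by (simp add: P_def power2_eq_square numeral_fps_const)
  ultimately show ?thesis by (simp add: P_def power2_eq_square algebra_simps)
qed

lemma gegenbauer_coeff_equation:
  "real (Suc k) * gegenbauer l (Suc k) x - 2 * x * (real k * gegenbauer l k x)
     + (if k = 0 then 0 else real (k - 1) * gegenbauer l (k - 1) x)
   = 2 * l * x * gegenbauer l k x - 2 * l * (if k = 0 then 0 else gegenbauer l (k - 1) x)"
proof -
  define G where "G = fps_binomial (-l) oo (fps_const (-2 * x) * fps_X + fps_X ^ 2)"
  have G: "gegenbauer l j x = fps_nth G j" for j by (simp only: gegenbauer_def G_def)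
  have "fps_nth (fps_deriv G) k - 2 * x * fps_nth (fps_X * fps_deriv G) k
      + fps_nth (fps_X * (fps_X * fps_deriv G)) k
    = 2 * l * x * fps_nth G k - 2 * l * fps_nth (fps_X * G) k"
    using arg_cong[OF gegenbauer_fps_ODE[of l x, folded G_def], of "\<lambda>f. fps_nth f k"]
    by (simp only: fps_add_nth fps_mult_left_const_nth) algebra
  moreover have "fps_nth (fps_deriv G) k = real (Suc k) * fps_nth G (Suc k)"
    "fps_nth (fps_X * fps_deriv G) k = real k * fps_nth G k"
    "fps_nth (fps_X * (fps_X * fps_deriv G)) k
      = (if k = 0 then 0 else real (k - 1) * fps_nth G (k - 1))"
    by (cases k; cases "k - 1"; simp)+
  ultimately show ?thesis unfolding G by (simp only: fps_X_mult_nth)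
qed

lemma gegenbauer_1: "gegenbauer l (Suc 0) x = 2 * l * x"
  using gegenbauer_coeff_equation[of 0 l x] by (simp add: gegenbauer_0)

lemma gegenbauer_recurrence:
  "(real k + 2) * gegenbauer l (Suc (Suc k)) x =
    2 * x * (real k + 1 + l) * gegenbauer l (Suc k) x - (real k + 2 * l) * gegenbauer l k x"
  using gegenbauer_coeff_equation[of "Suc k" l x] by (simp add: algebra_simps)

text \<open>
  Laplace's integral is usually taken over \<open>x + \<i> sqrt (1 - x\<^sup>2) t\<close> with density \<open>(1 - t\<^sup>2) powr (l - 1)\<close> for
  \<open>-1 < t < 1\<close>. The substitution \<open>t = 2 v - 1\<close> makes the density that of Euler's Beta integral.
\<close>
definition laplace_weight :: "real \<Rightarrow> real \<Rightarrow> real" where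
  "laplace_weight l v = v powr (l - 1) * (1 - v) powr (l - 1)"

definition laplace_point :: "real \<Rightarrow> real \<Rightarrow> complex" where
  "laplace_point x v = Complex x (sqrt (1 - x\<^sup>2) * (2 * v - 1))"

definition laplace_moment :: "real \<Rightarrow> real \<Rightarrow> nat \<Rightarrow> complex" where
  "laplace_moment l x k = integral {0..1} (\<lambda>v. laplace_weight l v *\<^sub>R laplace_point x v ^ k)"

lemma laplace_point_alt:
  "laplace_point x v = of_real x + \<i> * of_real (sqrt (1 - x\<^sup>2) * (2 * v - 1))"
  by (simp add: laplace_point_def Complex_eq)

lemma has_integral_laplace_moment:
  assumes l: "l > 0"
  shows "((\<lambda>v. laplace_weight l v *\<^sub>R laplace_point x v ^ k) has_integral laplace_moment l x k) {0..1}"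
proof -
  have "(\<lambda>v. laplace_weight l v *\<^sub>R laplace_point x v ^ k) absolutely_integrable_on {0..1}"
  proof (rule absolutely_integrable_bounded_measurable_product[where h = "\<lambda>c r. r *\<^sub>R c"])
    show "bilinear (\<lambda>(c::complex) r. r *\<^sub>R c)"
      by (auto simp: bilinear_def intro!: linearI simp: algebra_simps)
    have cont: "continuous_on {0..1} (\<lambda>v. laplace_point x v ^ k)"
      unfolding laplace_point_alt by (intro continuous_intros)
    then show "(\<lambda>v. laplace_point x v ^ k) \<in> borel_measurable (lebesgue_on {0..1})"
      by (intro continuous_imp_measurable_on_sets_lebesgue) auto
    show "bounded ((\<lambda>v. laplace_point x v ^ k) ` {0..1})"
      using cont by (intro compact_imp_bounded compact_continuous_image) auto
    have "laplace_weight l integrable_on {0..1}"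
      using integrable_Beta'[OF l l] by (simp add: laplace_weight_def[abs_def])
    then show "laplace_weight l absolutely_integrable_on {0..1}"
      by (rule nonnegative_absolutely_integrable_1) (simp add: laplace_weight_def)
  qed auto
  then show ?thesis unfolding laplace_moment_def
    using set_lebesgue_integral_eq_integral(1) integrable_integral by blast
qed

lemma laplace_moment_0:
  assumes "l > 0"
  shows "laplace_moment l x 0 = of_real (Beta l l)"
proof (rule has_integral_unique)
  show "((\<lambda>v. laplace_weight l v *\<^sub>R laplace_point x v ^ 0) has_integral laplace_moment l x 0) {0..1}"
    using assms by (rule has_integral_laplace_moment)
  show "((\<lambda>v. laplace_weight l v *\<^sub>R laplace_point x v ^ 0) has_integral of_real (Beta l l)) {0..1}"
    using has_integral_of_real[OF has_integral_Beta_real[OF assms assms], where 'b = complex]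
    by (simp add: laplace_weight_def scaleR_conv_of_real)
qed

text \<open>
  The integrand is, up to the constant factor \<open>c\<close>, the derivative of \<open>z ^ k * (v * (1 - v)) powr l\<close>,
  which vanishes at both ends. The factor arises from \<open>z\<^sup>2 - 2 x z + 1 = (1 - x\<^sup>2) (1 - t\<^sup>2)\<close> and
  \<open>z - x = \<i> sqrt (1 - x\<^sup>2) t\<close>, where \<open>t = 2 v - 1\<close>.
\<close>
lemma laplace_moment_recurrence_integral:
  fixes l x :: real and k :: nat
  assumes l: "l > 0" and x: "x\<^sup>2 \<le> 1"
  shows "((\<lambda>v. laplace_weight l v *\<^sub>R
    (of_real (2 * l) * (laplace_point x v - of_real x) * laplace_point x v ^ k +
     of_nat k * laplace_point x v ^ (k - 1) *
       (laplace_point x v ^ 2 - of_real (2 * x) * laplace_point x v + 1))) has_integral 0) {0..1}"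
proof -
  define s where "s = sqrt (1 - x\<^sup>2)"
  \<comment> \<open>chosen so that \<open>c * (2 * \<i> * s)\<close> is \<open>4 * s\<^sup>2\<close>\<close>
  define c where "c = - 2 * \<i> * of_real s"
  define z where "z = laplace_point x"
  have z: "z v = of_real x + \<i> * of_real (s * (2 * v - 1))" for v
    by (simp add: z_def laplace_point_alt s_def)
  have s2: "s * s = 1 - x * x" using x by (simp add: s_def flip: power2_eq_square)
  define g where "g v = v powr l * (1 - v) powr l" for v :: real
  define g' where "g' v = laplace_weight l v * (l * (1 - 2 * v))" for v :: real
  have "((\<lambda>v. c * (of_real (g' v) * z v ^ k + of_real (g v) * (of_nat k * z v ^ (k - 1) * (2 * \<i> * of_real s))))
      has_integral c * (of_real (g 1) * z 1 ^ k) - c * (of_real (g 0) * z 0 ^ k)) {0..1}"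
  proof (rule fundamental_theorem_of_calculus_interior)
    show "continuous_on {0..1} (\<lambda>v. c * (of_real (g v) * z v ^ k))"
      unfolding g_def z using l by (intro continuous_intros continuous_on_powr') auto
    fix v :: real assume v: "v \<in> {0<..<1}"
    have "(g has_real_derivative l * v powr (l - 1) * (1 - v) powr l - v powr l * (l * (1 - v) powr (l - 1))) (at v)"
      unfolding g_def using v by (auto intro!: derivative_eq_intros)
    moreover have "v powr l = v * v powr (l - 1)" "(1 - v) powr l = (1 - v) * (1 - v) powr (l - 1)"
      using v by (simp_all add: powr_mult_base)
    ultimately have "(g has_real_derivative g' v) (at v)"
      by (simp add: g'_def laplace_weight_def algebra_simps)
    then have 1: "((\<lambda>v. of_real (g v) :: complex) has_vector_derivative of_real (g' v)) (at v)"
      by (intro has_vector_derivative_of_real) (simp add: has_real_derivative_iff_has_vector_derivative)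
    have lin: "(z has_vector_derivative 2 * \<i> * of_real s) (at v)"
      unfolding z by (auto intro!: derivative_eq_intros simp: has_vector_derivative_def scaleR_conv_of_real)
    have "((\<lambda>w. w ^ k) has_field_derivative of_nat k * z v ^ (k - 1)) (at (z v))"
      by (auto intro!: derivative_eq_intros)
    from field_vector_diff_chain_at[OF lin this]
    have 2: "((\<lambda>v. z v ^ k) has_vector_derivative of_nat k * z v ^ (k - 1) * (2 * \<i> * of_real s)) (at v)"
      by (simp add: o_def mult_ac)
    show "((\<lambda>v. c * (of_real (g v) * z v ^ k)) has_vector_derivative
      c * (of_real (g' v) * z v ^ k + of_real (g v) * (of_nat k * z v ^ (k - 1) * (2 * \<i> * of_real s)))) (at v)"
      using has_vector_derivative_mult_right[OF has_vector_derivative_mult[OF 1 2], of c]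
      by (simp add: add.commute)
  qed simp
  then have ftc: "((\<lambda>v. c * (of_real (g' v) * z v ^ k + of_real (g v) * (of_nat k * z v ^ (k - 1) * (2 * \<i> * of_real s))))
      has_integral 0) {0..1}"
    using l by (simp add: g_def)
  show ?thesis
    unfolding z_def[symmetric]
  proof (rule has_integral_eq[OF _ ftc])
    fix v :: real assume v: "v \<in> {0..1}"
    have gv: "g v = laplace_weight l v * (v * (1 - v))"
    proof (cases "v = 0 \<or> v = 1")
      case True
      then show ?thesis using l by (auto simp: g_def)
    next
      case False
      then have "v powr l = v * v powr (l - 1)" "(1 - v) powr l = (1 - v) * (1 - v) powr (l - 1)"
        using v by (simp_all add: powr_mult_base)
      then show ?thesis by (simp add: g_def laplace_weight_def mult_ac)
    qed
    have 1: "c * of_real (l * (1 - 2 * v)) = of_real (2 * l) * (z v - of_real x)"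
      by (simp add: c_def z algebra_simps)
    have 2: "c * (of_real (v * (1 - v)) * (2 * \<i> * of_real s)) = z v ^ 2 - of_real (2 * x) * z v + 1"
    proof -
      have "z v ^ 2 - of_real (2 * x) * z v + 1 = of_real (1 - x * x - (s * s) * (2 * v - 1) ^ 2)"
        by (simp add: z power2_eq_square algebra_simps)
      also have "\<dots> = of_real (4 * (s * s) * (v * (1 - v)))"
        unfolding s2 by (simp add: power2_eq_square algebra_simps)
      finally show ?thesis by (simp add: c_def algebra_simps)
    qed
    show "c * (of_real (g' v) * z v ^ k + of_real (g v) * (of_nat k * z v ^ (k - 1) * (2 * \<i> * of_real s)))
      = laplace_weight l v *\<^sub>R
        (of_real (2 * l) * (z v - of_real x) * z v ^ k +
         of_nat k * z v ^ (k - 1) * (z v ^ 2 - of_real (2 * x) * z v + 1))"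
      unfolding 1[symmetric] 2[symmetric] gv g'_def scaleR_conv_of_real
      by (simp only: of_real_mult) (simp add: algebra_simps)
  qed
qed

lemma laplace_moment_1:
  assumes "l > 0" "x\<^sup>2 \<le> 1"
  shows "laplace_moment l x (Suc 0) = of_real x * laplace_moment l x 0"
proof -
  have "((\<lambda>v. of_real (2 * l) * (laplace_weight l v *\<^sub>R laplace_point x v ^ Suc 0) -
      of_real (2 * l * x) * (laplace_weight l v *\<^sub>R laplace_point x v ^ 0)) has_integral
      of_real (2 * l) * laplace_moment l x (Suc 0) - of_real (2 * l * x) * laplace_moment l x 0) {0..1}"
    using assms by (intro has_integral_diff has_integral_mult_right has_integral_laplace_moment)
  moreover have "((\<lambda>v. of_real (2 * l) * (laplace_weight l v *\<^sub>R laplace_point x v ^ Suc 0) -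
      of_real (2 * l * x) * (laplace_weight l v *\<^sub>R laplace_point x v ^ 0)) has_integral 0) {0..1}"
    by (rule has_integral_eq[OF _ laplace_moment_recurrence_integral[OF assms, of 0]])
      (simp add: scaleR_conv_of_real algebra_simps)
  ultimately have "of_real (2 * l) * laplace_moment l x (Suc 0) - of_real (2 * l * x) * laplace_moment l x 0 = 0"
    by (rule has_integral_unique)
  then show ?thesis using assms by simp
qed

lemma laplace_moment_recurrence:
  assumes "l > 0" "x\<^sup>2 \<le> 1"
  shows "of_real (real k + 1 + 2 * l) * laplace_moment l x (Suc (Suc k)) =
    of_real (2 * x * (real k + 1 + l)) * laplace_moment l x (Suc k) - of_real (real k + 1) * laplace_moment l x k"
proof -
  let ?f = "\<lambda>k v. laplace_weight l v *\<^sub>R laplace_point x v ^ k"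
  have "((\<lambda>v. of_real (real k + 1 + 2 * l) * ?f (Suc (Suc k)) v
      - (of_real (2 * x * (real k + 1 + l)) * ?f (Suc k) v - of_real (real k + 1) * ?f k v)) has_integral
      of_real (real k + 1 + 2 * l) * laplace_moment l x (Suc (Suc k))
      - (of_real (2 * x * (real k + 1 + l)) * laplace_moment l x (Suc k) - of_real (real k + 1) * laplace_moment l x k)) {0..1}"
    using assms by (intro has_integral_diff has_integral_mult_right has_integral_laplace_moment)
  moreover have "((\<lambda>v. of_real (real k + 1 + 2 * l) * ?f (Suc (Suc k)) v
      - (of_real (2 * x * (real k + 1 + l)) * ?f (Suc k) v - of_real (real k + 1) * ?f k v)) has_integral 0) {0..1}"
    by (rule has_integral_eq[OF _ laplace_moment_recurrence_integral[OF assms, of "Suc k"]])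
      (simp add: scaleR_conv_of_real power2_eq_square algebra_simps)
  ultimately have "of_real (real k + 1 + 2 * l) * laplace_moment l x (Suc (Suc k))
      - (of_real (2 * x * (real k + 1 + l)) * laplace_moment l x (Suc k)
        - of_real (real k + 1) * laplace_moment l x k) = 0"
    by (rule has_integral_unique)
  then show ?thesis by (simp only: right_minus_eq)
qed

text \<open>
  Both sides satisfy the three-term recurrence of the Gegenbauer polynomials and have the same
  first two values.
\<close>
lemma gegenbauer_laplace_integral:
  assumes l: "l > 0" and x: "x\<^sup>2 \<le> 1"
  shows "of_real (gegenbauer l k x * Beta l l) = of_real (bcoeff (2 * l) k) * laplace_moment l x k"
proof (induction k rule: induct_nat_012)
  case 0
  then show ?case using l by (simp add: gegenbauer_0 laplace_moment_0)
next
  case 1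
  then show ?case using l x
    by (simp add: gegenbauer_1 laplace_moment_1 laplace_moment_0 bcoeff_Suc)
next
  case (ge2 k)
  let ?b = "bcoeff (2 * l)" and ?M = "laplace_moment l x"
  have b1: "(real k + 2 * l) * ?b k = (real k + 1) * ?b (Suc k)"
    by (simp add: bcoeff_Suc add.commute)
  have b2: "(real k + 2) * ?b (Suc (Suc k)) = (real k + 1 + 2 * l) * ?b (Suc k)"
    by (simp add: bcoeff_Suc[of _ "Suc k"] add_ac)
  have "of_real ((real k + 2) * gegenbauer l (Suc (Suc k)) x * Beta l l)
      = of_real (2 * x * (real k + 1 + l)) * of_real (gegenbauer l (Suc k) x * Beta l l)
        - of_real (real k + 2 * l) * (of_real (gegenbauer l k x * Beta l l) :: complex)"
    unfolding gegenbauer_recurrence by (simp add: algebra_simps)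
  also have "\<dots> = of_real (2 * x * (real k + 1 + l)) * (of_real (?b (Suc k)) * ?M (Suc k))
        - of_real ((real k + 2 * l) * ?b k) * ?M k"
    unfolding ge2.IH by (simp only: of_real_mult mult.assoc)
  also have "\<dots> = of_real (?b (Suc k)) *
      (of_real (2 * x * (real k + 1 + l)) * ?M (Suc k) - of_real (real k + 1) * ?M k)"
    unfolding b1 by (simp only: of_real_mult right_diff_distrib mult_ac)
  also have "\<dots> = of_real ((real k + 2) * ?b (Suc (Suc k))) * ?M (Suc (Suc k))"
    unfolding laplace_moment_recurrence[OF l x, symmetric] b2 by (simp only: of_real_mult mult_ac)
  finally have eq: "of_real (real k + 2) * of_real (gegenbauer l (Suc (Suc k)) x * Beta l l)
      = of_real (real k + 2) * (of_real (?b (Suc (Suc k))) * ?M (Suc (Suc k)))"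
    by (simp only: of_real_mult mult.assoc)
  have "real k + 2 \<noteq> 0" by linarith
  then have "(of_real (real k + 2) :: complex) \<noteq> 0"
    by (simp only: of_real_eq_0_iff not_False_eq_True)
  from eq[unfolded mult_left_cancel[OF this]] show ?case .
qed

lemma gegenbauer_ratio_laplace_integral:
  assumes l: "l > 0" and x: "x\<^sup>2 \<le> 1"
  shows "((\<lambda>v. laplace_weight l v * Re (laplace_point x v ^ k)) has_integral
    Beta l l * (gegenbauer l k x / gegenbauer l k 1)) {0..1}"
proof -
  have Bpos: "Beta l l > 0" using l by (simp add: Beta_def Gamma_real_pos)
  have bpos: "bcoeff (2 * l) k > 0" using l by (intro bcoeff_pos) simp
  have "laplace_point 1 v = 1" for v by (simp add: laplace_point_def complex_eq_iff)
  then have "laplace_moment l 1 k = laplace_moment l 1 0" by (simp add: laplace_moment_def)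
  then have "(of_real (gegenbauer l k 1 * Beta l l) :: complex) = of_real (bcoeff (2 * l) k * Beta l l)"
    using gegenbauer_laplace_integral[OF l, of 1 k] l by (simp add: laplace_moment_0)
  then have g1: "gegenbauer l k 1 = bcoeff (2 * l) k"
    using Bpos by (simp only: of_real_eq_iff) simp
  have "laplace_moment l x k = of_real (Beta l l * (gegenbauer l k x / gegenbauer l k 1))"
    using gegenbauer_laplace_integral[OF l x, of k] bpos unfolding g1 by (simp add: field_simps)
  then show ?thesis
    using has_integral_linear[OF has_integral_laplace_moment[OF l, of x k] bounded_linear_Re]
    by (simp add: o_def)
qed

lemma integral_pos_if_continuous_pos:
  fixes f :: "real \<Rightarrow> real"
  assumes I: "(f has_integral I) {0..1}" and nonneg: "\<And>v. v \<in> {0..1} \<Longrightarrow> f v \<ge> 0"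
    and cont: "continuous_on {1/4..3/4} f" and pos: "\<And>v. v \<in> {1/4..3/4} \<Longrightarrow> f v > 0"
  shows "I > 0"
proof -
  obtain m where m: "m \<in> {1/4..3/4}" "\<And>v. v \<in> {1/4..3/4} \<Longrightarrow> f m \<le> f v"
    using continuous_attains_inf[of "{1/4..3/4::real}" f] cont by auto
  have int: "f integrable_on {1/4..3/4}" using cont by (rule integrable_continuous_interval)
  have "((\<lambda>_. f m) has_integral f m * (1/2)) {1/4..3/4::real}"
    using has_integral_const_real[of "f m" "1/4" "3/4"] by simp
  then have "f m * (1/2) \<le> integral {1/4..3/4} f"
    using m by (intro has_integral_le[OF _ integrable_integral[OF int]]) auto
  also have "\<dots> \<le> integral {0..1} f"
    using I int nonneg by (intro integral_subset_le) auto
  also have "\<dots> = I" using I by (rule integral_unique)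
  finally show ?thesis using pos[OF m(1)] by linarith
qed

section \<open>Positive sums of Gegenbauer polynomials\<close>

lemma gegenbauer_sum_pos:
  fixes a :: "nat \<Rightarrow> real"
  assumes bdry: "\<And>\<theta>. \<bar>\<theta>\<bar> \<le> pi \<Longrightarrow> (\<Sum>k=0..n. a k * cos (real k * \<theta>)) \<ge> 0"
    and a0: "a 0 > 0" and x: "-1 < x" "x < 1" and l: "l > 0"
  shows "(\<Sum>k=0..n. a k * (gegenbauer l k x / gegenbauer l k 1)) > 0"
proof -
  have x2: "x\<^sup>2 < 1" using x by (simp add: abs_square_less_1)
  define f where "f v = (\<Sum>k=0..n. a k * (laplace_weight l v * Re (laplace_point x v ^ k)))" for v
  have f: "f v = laplace_weight l v * Re (\<Sum>k=0..n. of_real (a k) * laplace_point x v ^ k)" for v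
    by (simp add: f_def sum_distrib_left mult_ac)
  have int: "(f has_integral (\<Sum>k=0..n. a k * (Beta l l * (gegenbauer l k x / gegenbauer l k 1)))) {0..1}"
    unfolding f_def using l x2
    by (intro has_integral_sum has_integral_mult_right gegenbauer_ratio_laplace_integral) auto
  have pos: "f v > 0" if v: "0 < v" "v < 1" for v
  proof -
    have "\<bar>2 * v - 1\<bar> < 1" using v by auto
    then have "(2 * v - 1)\<^sup>2 < 1" by (simp add: abs_square_less_1)
    define r where "r = (1 - x\<^sup>2) * (2 * v - 1)\<^sup>2"
    have "r < (1 - x\<^sup>2) * 1"
      unfolding r_def using x2 \<open>(2 * v - 1)\<^sup>2 < 1\<close> by (intro mult_strict_left_mono) auto
    moreover have "(norm (laplace_point x v))\<^sup>2 = x\<^sup>2 + r"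
      using x2 by (simp add: laplace_point_def r_def cmod_power2 power_mult_distrib)
    ultimately have "(norm (laplace_point x v))\<^sup>2 < 1" by simp
    then have norm1: "norm (laplace_point x v) < 1" by (simp add: abs_square_less_1)
    have "Re (\<Sum>k=0..n. of_real (a k) * laplace_point x v ^ k) > 0"
      by (rule Re_polynomial_pos_in_disc[where a = a and n = n, OF _ a0 norm1]) (rule bdry)
    moreover have "laplace_weight l v > 0" using v by (simp add: laplace_weight_def)
    ultimately show ?thesis unfolding f by (rule mult_pos_pos[rotated])
  qed
  have "(\<Sum>k=0..n. a k * (Beta l l * (gegenbauer l k x / gegenbauer l k 1))) > 0"
  proof (rule integral_pos_if_continuous_pos[OF int])
    show "f v \<ge> 0" if "v \<in> {0..1}" for v
    proof (cases "v = 0 \<or> v = 1")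
      case True
      then show ?thesis unfolding f by (auto simp: laplace_weight_def)
    next
      case False
      then show ?thesis using pos[of v] that by force
    qed
    show "continuous_on {1/4..3/4} f"
      unfolding f_def laplace_weight_def laplace_point_alt by (intro continuous_intros) auto
    show "f v > 0" if "v \<in> {1/4..3/4}" for v using pos[of v] that by simp
  qed
  also have "(\<Sum>k=0..n. a k * (Beta l l * (gegenbauer l k x / gegenbauer l k 1)))
      = Beta l l * (\<Sum>k=0..n. a k * (gegenbauer l k x / gegenbauer l k 1))"
    by (simp add: sum_distrib_left mult_ac)
  finally have "0 < Beta l l * (\<Sum>k=0..n. a k * (gegenbauer l k x / gegenbauer l k 1))" .
  moreover have "0 < Beta l l" using l by (simp add: Beta_def Gamma_real_pos)
  ultimately show ?thesis by (rule zero_less_mult_pos)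
qed

theorem corollary4p1:
  fixes b c \<alpha> l x :: real and n :: nat and a :: "nat \<Rightarrow> real"
  assumes "b \<ge> c" and "c > 0"
    and "\<alpha> \<ge> alpha0"
    and "n \<ge> 1"
    and "\<And>k. 1 \<le> k \<Longrightarrow> k \<le> n \<Longrightarrow> a (k - 1) \<ge> a k"
    and "a n > 0"
    and "\<And>k. 1 \<le> k \<Longrightarrow> k \<le> n \<Longrightarrow>
           (b + real n - real k) * real k * a k \<le> (c + real n - real k) * (real k - \<alpha>) * a (k - 1)"
    and "-1 < x" and "x < 1"
    and "l > 0"
  shows "(\<Sum>k=0..n. a k * (gegenbauer l k x / gegenbauer l k 1)) > 0"
proof -
  have pos: "a k > 0" if "k \<le> n" for k
    using that
  proof (induction rule: inc_induct)
    case (step k)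
    then show ?case using assms(5)[of "Suc k"] by simp
  qed (rule assms(6))
  have ratio: "real k * a k \<le> (real k - alpha0) * a (k - 1)" if k: "1 \<le> k" "k \<le> n" for k
  proof -
    define B C where "B = b + real n - real k" and "C = c + real n - real k"
    have BC: "0 < C" "C \<le> B" using assms(1,2) k by (simp_all add: B_def C_def)
    \<comment> \<open>positivity of the left side forces \<open>k > \<alpha>\<close>, so \<open>C\<close> may be enlarged to \<open>B\<close>\<close>
    have h: "B * (real k * a k) \<le> C * ((real k - \<alpha>) * a (k - 1))"
      using assms(7)[OF k] by (simp add: B_def C_def mult.assoc)
    have "0 < B * (real k * a k)" using BC k pos[of k] by simp
    then have "0 < C * ((real k - \<alpha>) * a (k - 1))" using h by linarith
    then have "0 < (real k - \<alpha>) * a (k - 1)" using BC by (simp add: zero_less_mult_iff)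
    then have "C * ((real k - \<alpha>) * a (k - 1)) \<le> B * ((real k - \<alpha>) * a (k - 1))"
      using BC by (intro mult_right_mono) auto
    with h have "B * (real k * a k) \<le> B * ((real k - \<alpha>) * a (k - 1))" by linarith
    then have "real k * a k \<le> (real k - \<alpha>) * a (k - 1)" using BC by simp
    also have "\<dots> \<le> (real k - alpha0) * a (k - 1)"
      using assms(3) pos[of "k - 1"] k by (intro mult_right_mono) (auto intro: less_imp_le)
    finally show ?thesis .
  qed
  have "(\<Sum>k=0..n. a k * cos (real k * \<theta>)) \<ge> 0" if "\<bar>\<theta>\<bar> \<le> pi" for \<theta>
    by (rule cos_sum_nonneg_general_coeffs[OF pos ratio that])
  then show ?thesis
    using pos[of 0] assms(8,9,10) by (intro gegenbauer_sum_pos) auto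
qed

end
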